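(* Let $d\ge1$, $\ell\ge2$ be integers, $r\ge2$, $A\in GL_d(\mathbb R)$ with $\rho(A)<1$, $\phi\in C^r(\mathbb S^1,\mathbb R^d)$, and let $\mathbf s=(s_1,\dots,s_t)\in\mathbb R^t$ with $s_i>-d_i/2$ for all $i$. Let $\mu_\phi$ be the SRB measure of $T(x,y)=(\ell x,\,Ay+\phi(x))$ and $\mu_{\phi,x}$ its conditional measure on the fiber $\{x\}\times\mathbb R^d$. Assume that $\mu_\phi\in L^2(\mathbb S^1,\dot H^{\mathbf s}_A)$. Then: (1) if $-d_i/2<s_i<0$ for every $i=1,\dots,t$, then for (Lebesgue) almost every $x\in\mathbb S^1$, setting $S=s_1+\dots+s_t$, $\dim_{\mathrm H}(\mu_{\phi,x})\ge d+2S$; (2) if $\mathbf s=0$, then $\mu_\phi$ is absolutely continuous with respect to the Lebesgue measure on $\mathbb S^1\times\mathbb R^d$.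
   Context: Setting. $\mathbb S^1=\mathbb R/\mathbb Z$; $\tau(x)=\ell x\pmod1$; $\mathcal A=\{1,\dots,\ell\}$, $\mathcal A^\infty=\mathcal A^{\mathbb N}$; $\mathcal P(k)=[(k-1)/\ell,k/\ell)$, $\mathcal P(\mathbf a)=\bigcap_{j=0}^{n-1}\tau^{-j}(\mathcal P(a_{n-j}))$ for $\mathbf a=(a_1,\dots,a_n)$; $[\mathbf a]_j$ is the prefix of length $j$; $\tau_{\mathbf a}^{-j}(x)$ is the unique point of $\mathcal P([\mathbf a]_j)$ mapped to $x$ by $\tau^j$; $S(x,\mathbf a)=\sum_{j=1}^\infty A^{j-1}\phi(\tau_{\mathbf a}^{-j}(x))$ for $\mathbf a\in\mathcal A^\infty$. SRB measure. $T$ has a unique SRB measure $\mu_\phi=\Psi_*(m\times\nu)$, with $\Psi(x,\mathbf a)=(x,S(x,\mathbf a))$, $m$ Lebesgue on $\mathbb S^1$ and $\nu$ the Bernoulli measure on $\mathcal A^\infty$ with equal weights $1/\ell$; thus $\mu_\phi=\int_{\mathbb S^1}\mu_{\phi,x}\,dx$ with $\mu_{\phi,x}=S(x,\cdot)_*\nu$. For a finite Borel measure, $\dim_{\mathrm H}(\mu)=\inf\{\dim_{\mathrm H}(Y):Y\text{ Borel of full }\mu\text{-measure}\}$. Spectral data. $1>|\lambda_1|>\dots>|\lambda_t|>0$ are the distinct moduli of the eigenvalues of $A$; $\mathbb R^d=E_1\oplus\dots\oplus E_t$, where $E_i$ is the real generalized spectral subspace of the transpose $A^T$ for the eigenvalues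 of modulus $|\lambda_i|$; $d_i=\dim E_i$; $\pi_i:\mathbb R^d\to E_i$ are the associated projections and $\eta_i=\pi_i(\eta)$. Function space. For $u\in C_c^\infty(\mathbb S^1\times\mathbb R^d)$, $\|u\|^2=\int_{\mathbb S^1}\int_{\mathbb R^d}|\mathcal F_yu(x,\eta)|^2\prod_{i=1}^t|\eta_i|^{2s_i}\,d\eta\,dx$, where $\mathcal F_y$ is the Fourier transform in the variable $y\in\mathbb R^d$. $L^2(\mathbb S^1,\dot H^{\mathbf s}_A)$ is the completion of $C_c^\infty(\mathbb S^1\times\mathbb R^d)$ in this norm; for a finite compactly supported Borel measure $\mu=\int_{\mathbb S^1}\mu_x\,dx$, membership means finiteness of $\int_{\mathbb S^1}\int_{\mathbb R^d}|\widehat{\mu_x}(\eta)|^2\prod_i|\eta_i|^{2s_i}\,d\eta\,dx$. *)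

theory Defs
  imports "HOL-Probability.Probability"
begin

section \<open>Expanding map, symbolic coding and the SRB measure\<close>

text \<open>The circle \<open>\<real>/\<int>\<close> is represented by its fundamental domain \<open>[0,1)\<close>;
  functions on it are functions of period \<open>1\<close> on the line.\<close>

definition circle_measure :: "real measure" where
  "circle_measure = restrict_space lborel {0..<1}"

definition C_circle :: "nat \<Rightarrow> (real \<Rightarrow> 'a::real_normed_vector) \<Rightarrow> bool" where
  "C_circle r \<phi> \<longleftrightarrow> (\<forall>x. \<phi> (x + 1) = \<phi> x) \<and>
     (\<exists>D. D 0 = \<phi> \<and>
        (\<forall>k<r. \<forall>x. (D k has_vector_derivative D (Suc k) x) (at x)) \<and>
        (\<forall>k\<le>r. continuous_on UNIV (D k)))"

definition tau :: "nat \<Rightarrow> real \<Rightarrow> real" where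
  "tau l x = frac (real l * x)"

definition cell :: "nat \<Rightarrow> nat \<Rightarrow> real set" where
  "cell l k = {(real k - 1) / real l ..< real k / real l}"

text \<open>An infinite word \<open>(a\<^sub>1, a\<^sub>2, \<dots>)\<close> is a sequence \<open>a\<close> with \<open>a\<^sub>j = a (j - 1)\<close>.
  \<open>cylinder l a n\<close> is the interval of the prefix \<open>(a\<^sub>1, \<dots>, a\<^sub>n)\<close>.\<close>

definition cylinder :: "nat \<Rightarrow> (nat \<Rightarrow> nat) \<Rightarrow> nat \<Rightarrow> real set" where
  "cylinder l a n = {x \<in> {0..<1}. \<forall>j<n. (tau l ^^ j) x \<in> cell l (a (n - j - 1))}"

definition inv_branch :: "nat \<Rightarrow> (nat \<Rightarrow> nat) \<Rightarrow> nat \<Rightarrow> real \<Rightarrow> real" where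
  "inv_branch l a j x = (THE z. z \<in> cylinder l a j \<and> (tau l ^^ j) z = x)"

text \<open>Matrix powers are written as iterates of \<open>(*v) A\<close>, since \<open>*\<close> and \<open>^\<close> on the type
  \<^typ>\<open>real^'n^'n\<close> are not the matrix product and its powers. The summation index is shifted
  by one, so that it starts at \<open>0\<close>.\<close>

definition S_sum :: "nat \<Rightarrow> real^'n^'n \<Rightarrow> (real \<Rightarrow> real^'n) \<Rightarrow> real \<Rightarrow> (nat \<Rightarrow> nat) \<Rightarrow> real^'n" where
  "S_sum l A \<phi> x a = (\<Sum>j. (((*v) A) ^^ j) (\<phi> (inv_branch l a (Suc j) x)))"

definition bernoulli_measure :: "nat \<Rightarrow> (nat \<Rightarrow> nat) measure" where
  "bernoulli_measure l = (\<Pi>\<^sub>M i\<in>UNIV. uniform_count_measure {1..l})"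

text \<open>The unique SRB measure of \<open>T(x,y) = (l x, A y + \<phi>(x))\<close> is the image of
  Lebesgue times Bernoulli measure under \<open>(x, a) \<mapsto> (x, S(x, a))\<close>; its conditional measure on the
  fibre over \<open>x\<close> is the law of \<open>S(x, \<cdot>)\<close>.\<close>

definition srb_measure ::
    "nat \<Rightarrow> real^'n^'n \<Rightarrow> (real \<Rightarrow> real^'n) \<Rightarrow> (real \<times> (real^'n)) measure" where
  "srb_measure l A \<phi> =
     distr (circle_measure \<Otimes>\<^sub>M bernoulli_measure l) (circle_measure \<Otimes>\<^sub>M borel)
       (\<lambda>(x, a). (x, S_sum l A \<phi> x a))"

definition srb_fibre ::
    "nat \<Rightarrow> real^'n^'n \<Rightarrow> (real \<Rightarrow> real^'n) \<Rightarrow> real \<Rightarrow> (real^'n) measure" where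
  "srb_fibre l A \<phi> x = distr (bernoulli_measure l) borel (S_sum l A \<phi> x)"


section \<open>Spectral data\<close>

definition complexify :: "real^'n \<Rightarrow> complex^'n" where
  "complexify v = (\<chi> i. of_real (v $ i))"

definition eigenvalues :: "real^'n^'n \<Rightarrow> complex set" where
  "eigenvalues A = {z. \<exists>v. v \<noteq> 0 \<and> map_matrix of_real A *v v = z *s v}"

definition spectral_radius :: "real^'n^'n \<Rightarrow> real" where
  "spectral_radius A = Max (cmod ` eigenvalues A)"

definition num_moduli :: "real^'n^'n \<Rightarrow> nat" where
  "num_moduli A = card (cmod ` eigenvalues A)"

text \<open>The distinct moduli in decreasing order, indexed by \<open>1, \<dots>, num_moduli A\<close>.\<close>

definition modulus :: "real^'n^'n \<Rightarrow> nat \<Rightarrow> real" where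
  "modulus A i = rev (sorted_list_of_set (cmod ` eigenvalues A)) ! (i - 1)"

definition gen_eigenspace :: "real^'n^'n \<Rightarrow> complex \<Rightarrow> (complex^'n) set" where
  "gen_eigenspace A z =
     {w. \<exists>k. (((*v) (map_matrix of_real A - mat z)) ^^ k) w = 0}"

text \<open>\<open>spectral_space A i\<close> is the space \<open>E\<^sub>i\<close> of the transpose: the real vectors in the complex sum
  of its generalized eigenspaces for the eigenvalues of modulus \<open>modulus A i\<close>. Here
  \<^const>\<open>vec.span\<close> is the span over the complex numbers.\<close>

definition spectral_space :: "real^'n^'n \<Rightarrow> nat \<Rightarrow> (real^'n) set" where
  "spectral_space A i =
     {v. complexify v \<in>
         vec.span (\<Union>z\<in>{z \<in> eigenvalues (transpose A). cmod z = modulus A i}.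
                     gen_eigenspace (transpose A) z)}"

definition spectral_proj :: "real^'n^'n \<Rightarrow> nat \<Rightarrow> real^'n \<Rightarrow> real^'n" where
  "spectral_proj A i \<eta> =
     (THE w. \<exists>f. (\<forall>j\<in>{1..num_moduli A}. f j \<in> spectral_space A j) \<and>
                 (\<Sum>j\<in>{1..num_moduli A}. f j) = \<eta> \<and> w = f i)"


section \<open>The anisotropic Sobolev space\<close>

text \<open>The normalisation of the frequency is irrelevant below: the weight is a product of
  homogeneous functions, so rescaling only multiplies the squared norm by a positive constant.\<close>

definition fourier_measure :: "(real^'n) measure \<Rightarrow> real^'n \<Rightarrow> complex" where
  "fourier_measure \<mu> \<eta> = (LINT y|\<mu>. cis (- (2 * pi * (\<eta> \<bullet> y))))"

definition disintegration :: "(real \<times> (real^'n)) measure \<Rightarrow> (real \<Rightarrow> (real^'n) measure) \<Rightarrow> bool" where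
  "disintegration \<mu> \<kappa> \<longleftrightarrow>
     sets \<mu> = sets (circle_measure \<Otimes>\<^sub>M borel) \<and>
     (\<forall>x\<in>{0..<1}. finite_measure (\<kappa> x) \<and> sets (\<kappa> x) = sets borel) \<and>
     (\<forall>B\<in>sets borel. (\<lambda>x. emeasure (\<kappa> x) B) \<in> borel_measurable circle_measure) \<and>
     (\<forall>C\<in>sets \<mu>. emeasure \<mu> C = (\<integral>\<^sup>+x. emeasure (\<kappa> x) (Pair x -` C) \<partial>circle_measure))"

text \<open>Membership of a finite compactly supported measure \<open>\<mu> = \<integral> \<mu>\<^sub>x dx\<close> in the space. The points
  \<open>\<eta>\<close> with a vanishing component, where \<open>powr\<close> takes the value \<open>0\<close> by convention, form a
  Lebesgue null set.\<close>

definition in_L2_H :: "real^'n^'n \<Rightarrow> (nat \<Rightarrow> real) \<Rightarrow> (real \<times> (real^'n)) measure \<Rightarrow> bool" where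
  "in_L2_H A s \<mu> \<longleftrightarrow> (\<exists>\<kappa>. disintegration \<mu> \<kappa> \<and>
     (\<integral>\<^sup>+x. (\<integral>\<^sup>+\<eta>. ennreal ((cmod (fourier_measure (\<kappa> x) \<eta>))\<^sup>2 *
          (\<Prod>i\<in>{1..num_moduli A}. norm (spectral_proj A i \<eta>) powr (2 * s i)))
        \<partial>lborel) \<partial>circle_measure) < \<infinity>)"


section \<open>Hausdorff dimension\<close>

text \<open>\<open>diam(U)\<^sup>t\<close>, with the conventions \<open>diam(\<emptyset>)\<^sup>t = 0\<close> and \<open>diam(U)\<^sup>0 = 1\<close> for nonempty \<open>U\<close>.\<close>

definition diam_pow :: "real \<Rightarrow> 'a::metric_space set \<Rightarrow> ennreal" where
  "diam_pow t U = (if U = {} then 0 else if t = 0 then 1 else ennreal (diameter U powr t))"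

text \<open>Covering sets are required to be bounded, because \<^const>\<open>diameter\<close> carries no information
  on unbounded sets.\<close>

definition hausdorff_content :: "real \<Rightarrow> real \<Rightarrow> 'a::metric_space set \<Rightarrow> ennreal" where
  "hausdorff_content t \<delta> Y =
     Inf {(\<Sum>n. diam_pow t (U n)) | U :: nat \<Rightarrow> 'a set.
            Y \<subseteq> (\<Union>n. U n) \<and> (\<forall>n. bounded (U n) \<and> diameter (U n) \<le> \<delta>)}"

definition hausdorff_measure :: "real \<Rightarrow> 'a::metric_space set \<Rightarrow> ennreal" where
  "hausdorff_measure t Y = (SUP \<delta>\<in>{0<..}. hausdorff_content t \<delta> Y)"

definition hausdorff_dim :: "'a::metric_space set \<Rightarrow> ereal" where
  "hausdorff_dim Y = Inf {ereal t | t. t \<ge> 0 \<and> hausdorff_measure t Y = 0}"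

definition hausdorff_dim_measure :: "'a::metric_space measure \<Rightarrow> ereal" where
  "hausdorff_dim_measure \<mu> =
     Inf {hausdorff_dim Y | Y. Y \<in> sets borel \<and> emeasure \<mu> (space \<mu> - Y) = 0}"

end

theory Submission
  imports Defs "HOL-Computational_Algebra.Fundamental_Theorem_Algebra"
begin

text \<open>
  Both statements follow from one estimate. Write \<open>\<mu>\<^sub>x\<close> for the fibre measures, \<open>n\<close> for the dimension
  of the fibre and \<open>S\<close> for the sum of the exponents, which are all nonpositive in either case. For
  almost every \<open>x\<close> there is a constant \<open>C\<close> such that, for all \<open>\<epsilon> > 0\<close>,

  \<open>(\<mu>\<^sub>x \<times> \<mu>\<^sub>x) {(y, z). \<bar>y - z\<bar> \<le> \<epsilon>} \<le> C \<epsilon>\<^bsup>n + 2S\<^esup>\<close>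

  (\<open>fibre_correlation_bound\<close>). To see this, dominate the indicator of the left-hand side by a
  Gaussian of width \<open>\<epsilon>\<close> and pass to the Fourier side, where one integrates the squared modulus of
  the transform of \<open>\<mu>\<^sub>x\<close> against \<open>\<epsilon>\<^sup>n exp (- c \<epsilon>\<^sup>2 \<bar>\<eta>\<bar>\<^sup>2)\<close>
  (\<open>fourier_gauss_identity\<close>). A Gaussian is below a multiple of any negative power, so this factor is
  at most a constant times \<open>\<epsilon>\<^bsup>n + 2S\<^esup> \<bar>\<eta>\<bar>\<^bsup>2S\<^esup>\<close>. Since the spectral projections are bounded and the
  exponents nonpositive, \<open>\<bar>\<eta>\<bar>\<^bsup>2S\<^esup>\<close> is in turn at most a constant times the anisotropic weight
  (\<open>spectral_weight_ge\<close>), against which the squared transform is integrable for almost every \<open>x\<close> by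
  hypothesis.

  For the dimension, the estimate gives, for every \<open>t < n + 2S\<close> and \<open>\<mu>\<^sub>x\<close>-almost every \<open>y\<close>, a bound
  \<open>\<mu>\<^sub>x(B(y, \<rho>)) \<le> C\<^sub>y \<rho>\<^sup>t\<close> at dyadic radii \<open>\<rho>\<close>, and the mass distribution principle applies
  (\<open>hausdorff_dim_measure_ge\<close>).

  For absolute continuity, the estimate with exponent \<open>n\<close> bounds the mollifications of \<open>\<mu>\<^sub>x\<close> by
  indicators of balls uniformly in \<open>L\<^sup>2\<close>. Hence the squared mass of an open set is at most a constant
  times its volume (\<open>open_measure_bound\<close>), and null sets have arbitrarily small open neighbourhoods.
  Absolute continuity of almost all fibres passes to \<open>\<mu>\<close> by integration.

  Two preparations are needed. The spectral projections are defined by a description, so the spectral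
  spaces have to be shown to decompose the real space; and an arbitrary disintegration has to be
  identified with the laws of \<open>S(x, \<cdot>)\<close> for almost every \<open>x\<close>
  (\<open>disintegration_unique\<close>).
\<close>

section \<open>The spectral decomposition\<close>

definition gen_eig :: "complex^'n^'n \<Rightarrow> complex \<Rightarrow> (complex^'n) set" where
  "gen_eig M z = {w. \<exists>k. (((*v) (M - mat z)) ^^ k) w = 0}"

lemma mat_mult: "mat z *v w = z *s (w :: complex^'n)"
  by (auto simp: vec_eq_iff matrix_vector_mult_def mat_def if_distrib if_distribR cong: if_cong)

lemma mat_diff_mult: "(M - mat z) *v w = M *v w - z *s (w :: complex^'n)"
  by (simp add: matrix_vector_mult_diff_rdistrib mat_mult)

lemma funpow_mult_zero: "(((*v) (M :: complex^'n^'n)) ^^ k) 0 = 0"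
  by (induction k) auto

lemma funpow_mult_add: "(((*v) (M :: complex^'n^'n)) ^^ k) (x + y) = (((*v) M) ^^ k) x + (((*v) M) ^^ k) y"
  by (induction k) (auto simp: matrix_vector_right_distrib)

lemma funpow_mult_scale: "(((*v) (M :: complex^'n^'n)) ^^ k) (c *s x) = c *s (((*v) M) ^^ k) x"
  by (induction k) (auto simp: vec.scale)

lemma funpow_mult_mono:
  assumes "(((*v) (M :: complex^'n^'n)) ^^ k) w = 0" "k \<le> m"
  shows "(((*v) M) ^^ m) w = 0"
proof -
  have "m = (m - k) + k" using assms(2) by simp
  then show ?thesis
    using assms(1) funpow_mult_zero[of "m - k" M] by (metis comp_apply funpow_add)
qed

lemma shift_commute:
  "(M - mat y) *v ((((*v) (M - mat z)) ^^ k) w) = (((*v) (M - mat z)) ^^ k) ((M - mat y) *v (w :: complex^'n))"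
proof (induction k)
  case (Suc k)
  have "(M - mat y) *v ((M - mat z) *v u) = (M - mat z) *v ((M - mat y) *v u)" for u :: "complex^'n"
    by (simp add: mat_mult vec.scale algebra_simps)
  then show ?case using Suc by simp
qed simp

lemma subspace_gen_eig: "vec.subspace (gen_eig M z)"
proof (rule vec.subspaceI)
  show "0 \<in> gen_eig M z" by (auto simp: gen_eig_def intro!: exI[of _ 0])
next
  fix x y assume "x \<in> gen_eig M z" "y \<in> gen_eig M z"
  then obtain k m where "(((*v) (M - mat z)) ^^ k) x = 0" "(((*v) (M - mat z)) ^^ m) y = 0"
    by (auto simp: gen_eig_def)
  then have "(((*v) (M - mat z)) ^^ max k m) (x + y) = 0"
    unfolding funpow_mult_add by (simp add: funpow_mult_mono[of k _ x] funpow_mult_mono[of m _ y])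
  then show "x + y \<in> gen_eig M z" by (auto simp: gen_eig_def)
next
  fix c x assume "x \<in> gen_eig M z"
  then show "c *s x \<in> gen_eig M z" by (auto simp: gen_eig_def funpow_mult_scale)
qed

lemma gen_eig_invariant: "w \<in> gen_eig M z \<Longrightarrow> (M - mat y) *v w \<in> gen_eig M z"
  by (auto simp: gen_eig_def shift_commute[symmetric]) (metis vec.zero)

lemma gen_eig_inj:
  assumes "w \<in> gen_eig M z" "(M - mat y) *v w = 0" "y \<noteq> z"
  shows "w = 0"
proof -
  have "(M - mat z) *v w = (y - z) *s w"
    using assms(2) by (simp add: mat_diff_mult vec.scale_left_diff_distrib)
  then have "(((*v) (M - mat z)) ^^ k) w = (y - z)^k *s w" for k
    by (induction k) (simp_all add: vec.scale vec.scale_left_diff_distrib left_diff_distrib mult.commute)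
  with assms(1,3) show ?thesis by (auto simp: gen_eig_def)
qed

lemma gen_eig_inj_pow:
  assumes "w \<in> gen_eig M z" "(((*v) (M - mat y)) ^^ k) w = 0" "y \<noteq> z"
  shows "w = 0"
  using assms(1,2)
proof (induction k arbitrary: w)
  case (Suc k)
  have "(M - mat y) *v w = 0"
    using Suc.IH[of "(M - mat y) *v w"] Suc.prems gen_eig_invariant[OF Suc.prems(1)] by (simp add: funpow_swap1)
  then show ?case using gen_eig_inj Suc.prems assms(3) by blast
qed simp

text \<open>On the generalized eigenspace of \<open>z\<close> the operator \<open>M - y\<close> is the nilpotent \<open>M - z\<close> plus the
  nonzero scalar \<open>z - y\<close>, so it is inverted by a finite Neumann series. The induction on the
  nilpotency order produces that series one term at a time.\<close>

lemma gen_eig_surj: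
  assumes "w \<in> gen_eig M z" "y \<noteq> z"
  shows "\<exists>u\<in>gen_eig M z. (M - mat y) *v u = w"
proof -
  obtain k where "(((*v) (M - mat z)) ^^ k) w = 0" using assms by (auto simp: gen_eig_def)
  then show ?thesis
    using assms(1)
  proof (induction k arbitrary: w)
    case 0
    then show ?case using vec.subspace_0[OF subspace_gen_eig] by (intro bexI[of _ 0]) auto
  next
    case (Suc k)
    let ?c = "1 / (z - y)"
    have "(((*v) (M - mat z)) ^^ k) (?c *s ((M - mat z) *v w)) = 0"
      using Suc.prems by (simp add: funpow_mult_scale funpow_swap1)
    moreover have mem: "?c *s ((M - mat z) *v w) \<in> gen_eig M z"
      using Suc.prems gen_eig_invariant subspace_gen_eig vec.subspace_scale by blast
    ultimately obtain u where u: "u \<in> gen_eig M z" "(M - mat y) *v u = ?c *s ((M - mat z) *v w)"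
      using Suc.IH by blast
    have "?c *s ((M - mat z) *v w) + w = ?c *s ((M - mat y) *v w)"
      using assms(2) by (auto simp: mat_diff_mult vec_eq_iff field_simps)
    moreover have "(M - mat y) *v (?c *s w - u) = ?c *s ((M - mat y) *v w) - (M - mat y) *v u"
      by (simp only: matrix_vector_mult_diff_distrib vec.scale)
    ultimately have "(M - mat y) *v (?c *s w - u) = w"
      using u(2) by (metis add_diff_cancel_left')
    moreover have "?c *s w - u \<in> gen_eig M z"
      using u(1) Suc.prems subspace_gen_eig vec.subspace_scale vec.subspace_diff by blast
    ultimately show ?case by blast
  qed
qed

text \<open>A power of \<open>M - y\<close> kills the component of \<open>y\<close> and is injective on all the others, which
  reduces a vanishing sum to one with fewer summands.\<close>

lemma gen_eig_independent:
  assumes "finite F" "\<And>z. z \<in> F \<Longrightarrow> g z \<in> gen_eig M z" "sum g F = 0" "z \<in> F"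
  shows "g z = 0"
  using assms
proof (induction F arbitrary: g z rule: finite_induct)
  case (insert y F)
  obtain k where k: "(((*v) (M - mat y)) ^^ k) (g y) = 0"
    using insert.prems(1)[of y] by (auto simp: gen_eig_def)
  let ?N = "((*v) (M - mat y)) ^^ k"
  have N_sum: "?N (sum g F) = (\<Sum>z\<in>F. ?N (g z))"
    using \<open>finite F\<close> by (induction F rule: finite_induct) (auto simp: funpow_mult_zero funpow_mult_add)
  have N_inv: "w \<in> gen_eig M z \<Longrightarrow> ?N w \<in> gen_eig M z" for w z
    by (induction k) (auto intro: gen_eig_invariant)
  have "?N (g y + sum g F) = 0"
    using insert by (simp add: funpow_mult_zero)
  then have "(\<Sum>z\<in>F. ?N (g z)) = 0"
    by (simp add: funpow_mult_add k N_sum)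
  then have "?N (g x) = 0" if "x \<in> F" for x
    using insert.IH[of "\<lambda>z. ?N (g z)" x] insert.prems(1) N_inv that by simp
  then have zero: "g x = 0" if "x \<in> F" for x
    using gen_eig_inj_pow[of "g x" M x k y] insert.prems(1) insert.hyps that by blast
  then have "g y = 0" using insert by simp
  with zero insert.prems(3) show ?case by blast
qed simp

text \<open>The vectors \<open>v, M v, \<dots>, M\<^sup>n v\<close> are \<open>n + 1\<close> vectors of an \<open>n\<close>-dimensional space; two of them
  may coincide, and then the difference of two monomials serves as the polynomial.\<close>

lemma annihilating_poly:
  fixes M :: "complex^'n^'n"
  shows "\<exists>p N. p \<noteq> 0 \<and> degree p < N \<and> (\<Sum>i<N. coeff p i *s (((*v) M) ^^ i) v) = 0"
proof -
  define f where "f i = (((*v) M) ^^ i) v" for i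
  define N where "N = CARD('n) + 1"
  show ?thesis
  proof (cases "inj_on f {..<N}")
    case True
    then have "card (f ` {..<N}) = N" by (simp add: card_image)
    then have "vec.dependent (f ` {..<N})"
      using dim_subset_UNIV_cart_gen[of "f ` {..<N}"]
      by (intro vec.dependent_biggerset_general) (simp add: N_def)
    then obtain u where u: "\<exists>w\<in>f ` {..<N}. u w \<noteq> 0" "(\<Sum>w\<in>f ` {..<N}. u w *s w) = 0"
      by (subst (asm) vec.dependent_finite) auto
    define p where "p = (\<Sum>i<N. monom (u (f i)) i)"
    have c: "coeff p i = (if i < N then u (f i) else 0)" for i
      by (simp add: p_def coeff_sum)
    have "p \<noteq> 0"
      using u(1) c by (metis (no_types, lifting) coeff_0 imageE lessThan_iff)
    moreover have "degree p < N"
      using c by (metis leading_coeff_0_iff \<open>p \<noteq> 0\<close>)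
    moreover have "(\<Sum>i<N. coeff p i *s f i) = 0"
      using u(2) True by (simp add: c sum.reindex)
    ultimately show ?thesis unfolding f_def by blast
  next
    case False
    then obtain i j where ij: "i \<noteq> j" "f i = f j" by (auto simp: inj_on_def)
    define p :: "complex poly" where "p = monom 1 i - monom 1 j"
    have "p \<noteq> 0"
      using ij by (auto simp: p_def poly_eq_iff)
    moreover have "(\<Sum>k<Suc (max (degree p) (max i j)). coeff p k *s f k) = 0"
    proof -
      have "(\<Sum>k<Suc (max (degree p) (max i j)). coeff p k *s f k)
          = (\<Sum>k<Suc (max (degree p) (max i j)). (if k = i then f k else 0) - (if k = j then f k else 0))"
        using ij by (intro sum.cong) (auto simp: p_def)
      also have "\<dots> = 0" using ij by (subst sum_subtractf) (auto simp: sum.delta)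
      finally show ?thesis .
    qed
    moreover have "degree p < Suc (max (degree p) (max i j))" by simp
    ultimately show ?thesis unfolding f_def by blast
  qed
qed

text \<open>This closure property lets a linear factor be stripped from an annihilating polynomial:
  \<open>M - z\<close> maps the sum of the other generalized eigenspaces onto itself, so modulo that sum
  \<open>w\<close> lies in the generalized eigenspace of \<open>z\<close>.\<close>

lemma gen_eig_span_preimage:
  assumes "(M - mat z) *v w \<in> vec.span (\<Union>y. gen_eig M y)"
  shows "w \<in> vec.span (\<Union>y. gen_eig M y)"
proof -
  let ?V = "vec.span (\<Union>y\<in>-{z}. gen_eig M y)"
  have split: "(\<Union>y. gen_eig M y) = gen_eig M z \<union> (\<Union>y\<in>-{z}. gen_eig M y)" by auto
  obtain a b where ab: "(M - mat z) *v w = a + b" "a \<in> gen_eig M z" "b \<in> ?V"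
    using assms unfolding split vec.span_Un
    by (auto simp: vec.span_eq_iff[THEN iffD2, OF subspace_gen_eig])
  have "?V \<subseteq> (*v) (M - mat z) ` ?V"
  proof (rule vec.span_minimal)
    show "(\<Union>y\<in>-{z}. gen_eig M y) \<subseteq> (*v) (M - mat z) ` ?V"
    proof
      fix x assume "x \<in> (\<Union>y\<in>-{z}. gen_eig M y)"
      then obtain y where y: "y \<noteq> z" "x \<in> gen_eig M y" by auto
      then obtain u where "u \<in> gen_eig M y" "(M - mat z) *v u = x"
        using gen_eig_surj[of x M y z] by auto
      with y show "x \<in> (*v) (M - mat z) ` ?V"
        by (intro image_eqI[of _ _ u]) (auto intro: vec.span_base)
    qed
    show "vec.subspace ((*v) (M - mat z) ` ?V)"
      by (intro vec.subspace_image vec.subspace_span)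
  qed
  then obtain b' where b': "b' \<in> ?V" "b = (M - mat z) *v b'" using ab(3) by blast
  have "(M - mat z) *v (w - b') \<in> gen_eig M z"
    using ab b' by (simp add: matrix_vector_mult_diff_distrib)
  then have "w - b' \<in> gen_eig M z"
    by (auto simp: gen_eig_def funpow_swap1) (metis funpow.simps(2) funpow_swap1 comp_apply)
  then have "(w - b') + b' \<in> vec.span (gen_eig M z \<union> (\<Union>y\<in>-{z}. gen_eig M y))"
    unfolding vec.span_Un using b' vec.span_base by blast
  then show ?thesis unfolding split by simp
qed

lemma gen_eig_span_poly:
  fixes M :: "complex^'n^'n"
  assumes "p \<noteq> 0" "degree p < N" "(\<Sum>i<N. coeff p i *s (((*v) M) ^^ i) v) \<in> vec.span (\<Union>y. gen_eig M y)"
  shows "v \<in> vec.span (\<Union>y. gen_eig M y)"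
  using assms
proof (induction "degree p" arbitrary: p N)
  case 0
  then have c: "coeff p 0 \<noteq> 0" using leading_coeff_0_iff[of p] by simp
  have "coeff p i = 0" if "i > 0" for i using 0 that coeff_eq_0 by metis
  then have "(\<Sum>i<N. coeff p i *s (((*v) M) ^^ i) v) = coeff p 0 *s v"
    using 0 by (subst sum.mono_neutral_right[of _ "{0}"]) auto
  then have "inverse (coeff p 0) *s (coeff p 0 *s v) \<in> vec.span (\<Union>y. gen_eig M y)"
    using 0 vec.span_scale by metis
  then show ?case using c by simp
next
  case (Suc n)
  obtain z where "poly p z = 0"
    using fundamental_theorem_of_algebra[of p] Suc.hyps(2) by (auto simp: constant_degree)
  then obtain q where q: "p = [:- z, 1:] * q" by (metis poly_eq_0_iff_dvd dvdE)
  have q0: "q \<noteq> 0" using q Suc.prems by auto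
  have "degree p = Suc (degree q)" unfolding q using q0 by (subst degree_mult_eq) auto
  then have dq: "degree q = n" "degree q < N - 1" using Suc by auto
  define N' where "N' = N - 1"
  have N: "N = Suc N'" using Suc.prems(2) by (simp add: N'_def)
  have p: "p = pCons 0 q - smult z q" using q by simp
  let ?S = "\<Sum>i<N'. coeff q i *s (((*v) M) ^^ i) v"
  have "(\<Sum>i<N. coeff p i *s (((*v) M) ^^ i) v)
      = (\<Sum>i<N. coeff (pCons 0 q) i *s (((*v) M) ^^ i) v) - (\<Sum>i<N. (z * coeff q i) *s (((*v) M) ^^ i) v)"
    unfolding p by (simp add: vec.scale_left_diff_distrib sum_subtractf)
  also have "(\<Sum>i<N. coeff (pCons 0 q) i *s (((*v) M) ^^ i) v) = M *v ?S"
    unfolding N by (subst sum.lessThan_Suc_shift) (simp add: vec.sum vec.scale)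
  also have "(\<Sum>i<N. (z * coeff q i) *s (((*v) M) ^^ i) v) = z *s ?S"
    using coeff_eq_0[of q N'] dq(2)[folded N'_def] unfolding N by (simp add: vec.scale_sum_right)
  finally have "(\<Sum>i<N. coeff p i *s (((*v) M) ^^ i) v) = (M - mat z) *v ?S"
    by (simp add: mat_diff_mult)
  with Suc.prems(3) have "(M - mat z) *v ?S \<in> vec.span (\<Union>y. gen_eig M y)"
    by (simp only:)
  then have "?S \<in> vec.span (\<Union>y. gen_eig M y)"
    by (rule gen_eig_span_preimage)
  then show ?case using Suc.hyps(1)[of q N'] dq q0 by (simp add: N'_def)
qed

text \<open>The primary decomposition over the complex numbers: every vector is annihilated by some
  polynomial in \<open>M\<close>, and the linear factors of this polynomial can be stripped one by one.\<close>

lemma gen_eig_span: "vec.span (\<Union>y. gen_eig M y) = UNIV"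
proof -
  have "v \<in> vec.span (\<Union>y. gen_eig M y)" for v
  proof -
    obtain p N where "p \<noteq> 0" "degree p < N" "(\<Sum>i<N. coeff p i *s (((*v) M) ^^ i) v) = 0"
      using annihilating_poly by blast
    then show ?thesis using gen_eig_span_poly[of p N M v] vec.span_zero by metis
  qed
  then show ?thesis by auto
qed

lemma gen_eig_nontrivial:
  assumes "w \<in> gen_eig M z" "w \<noteq> 0"
  shows "\<exists>v. v \<noteq> 0 \<and> M *v v = z *s v"
proof -
  obtain k where "(((*v) (M - mat z)) ^^ k) w = 0" using assms by (auto simp: gen_eig_def)
  then show ?thesis
    using assms(2)
  proof (induction k arbitrary: w)
    case (Suc k)
    show ?case
    proof (cases "(M - mat z) *v w = 0")
      case True
      then show ?thesis using Suc.prems(2) by (intro exI[of _ w]) (simp add: mat_diff_mult)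
    next
      case False
      then show ?thesis using Suc.IH[of "(M - mat z) *v w"] Suc.prems(1) by (simp add: funpow_swap1)
    qed
  qed simp
qed

lemma finite_eigenvalues: "finite (eigenvalues (A :: real^'n^'n))"
proof -
  define M :: "complex^'n^'n" where "M = map_matrix of_real A"
  obtain u where u: "\<And>z. z \<in> eigenvalues A \<Longrightarrow> u z \<noteq> 0 \<and> M *v u z = z *s u z"
    using bchoice[of "eigenvalues A" "\<lambda>z v. v \<noteq> 0 \<and> M *v v = z *s v"]
    unfolding eigenvalues_def M_def by blast
  have u_mem: "u z \<in> gen_eig M z" if "z \<in> eigenvalues A" for z
    using u[OF that] by (auto simp: gen_eig_def mat_diff_mult intro!: exI[of _ 1])
  have indep: "c z = 0" if "finite F" "F \<subseteq> eigenvalues A" "(\<Sum>z\<in>F. c z *s u z) = 0" "z \<in> F" for F c z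
  proof -
    have "c z *s u z = 0"
      using gen_eig_independent[OF that(1), of "\<lambda>z. c z *s u z" M z] that u_mem
        vec.subspace_scale[OF subspace_gen_eig] by blast
    then show ?thesis using u[of z] that by auto
  qed
  have inj: "inj_on u (eigenvalues A)"
  proof (rule inj_onI, rule ccontr)
    fix y z assume yz: "y \<in> eigenvalues A" "z \<in> eigenvalues A" "u y = u z" "y \<noteq> z"
    then show False
      using indep[of "{y, z}" "\<lambda>x. if x = y then 1 else - 1" y] by auto
  qed
  have "vec.independent (u ` eigenvalues A)"
    unfolding vec.independent_explicit_module
  proof (intro allI impI)
    fix T c v assume T: "finite T" "T \<subseteq> u ` eigenvalues A" "(\<Sum>w\<in>T. c w *s w) = 0" "v \<in> T"
    from T(2) obtain F where F: "F \<subseteq> eigenvalues A" "T = u ` F" by (rule subset_imageE)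
    have inj_F: "inj_on u F" using inj F(1) by (rule inj_on_subset)
    have "finite F" using T(1) F(2) inj_F by (simp add: finite_image_iff)
    moreover have "(\<Sum>z\<in>F. c (u z) *s u z) = 0" using T(3) inj_F unfolding F(2) by (simp add: sum.reindex)
    ultimately show "c v = 0" using indep[of F "\<lambda>z. c (u z)"] F T(4) by blast
  qed
  then have "finite (u ` eigenvalues A)" by (rule vec.finiteI_independent)
  then show ?thesis using inj by (simp add: finite_image_iff)
qed

lemma eigenvalues_transpose: "eigenvalues (transpose A) = eigenvalues (A :: real^'n^'n)"
proof -
  have iff: "z \<in> eigenvalues B \<longleftrightarrow> \<not> (\<exists>C. C ** (map_matrix of_real B - mat z) = mat 1)"
    for z and B :: "real^'n^'n"
    unfolding matrix_left_invertible_ker by (auto simp: eigenvalues_def mat_diff_mult)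
  have "map_matrix of_real (transpose A) - mat z = transpose (map_matrix of_real A - mat z :: complex^'n^'n)" for z
    by (auto simp: vec_eq_iff transpose_def mat_def)
  then show ?thesis
    using iff[of _ A] iff[of _ "transpose A"] left_invertible_transpose matrix_left_right_inverse
    by (metis (no_types, lifting) set_eq_iff)
qed

lemma modulus_bij: "bij_betw (modulus A) {1..num_moduli A} (cmod ` eigenvalues A)"
proof -
  define L where "L = rev (sorted_list_of_set (cmod ` eigenvalues A))"
  have L: "distinct L" "set L = cmod ` eigenvalues A" "length L = num_moduli A"
    by (simp_all add: L_def finite_eigenvalues num_moduli_def)
  have "bij_betw ((!) L) {..<num_moduli A} (cmod ` eigenvalues A)"
    using L by (intro bij_betw_nth) auto
  moreover have "bij_betw (\<lambda>i. i - 1) {1..num_moduli A} {..<num_moduli A}"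
    by (rule bij_betw_byWitness[where f' = Suc]) auto
  ultimately have "bij_betw ((!) L \<circ> (\<lambda>i. i - 1)) {1..num_moduli A} (cmod ` eigenvalues A)"
    by (rule bij_betw_trans[rotated])
  then show ?thesis by (simp add: comp_def L_def modulus_def[abs_def])
qed

lemma span_UN_sum:
  fixes V :: "'i \<Rightarrow> ('a::field^'n) set"
  assumes "finite I" "x \<in> vec.span (\<Union>i\<in>I. V i)"
  shows "\<exists>f. (\<forall>i\<in>I. f i \<in> vec.span (V i)) \<and> x = sum f I"
  using assms
proof (induction I arbitrary: x rule: finite_induct)
  case (insert i I)
  have "x \<in> vec.span (V i \<union> (\<Union>i\<in>I. V i))" using insert.prems by simp
  then obtain a b where ab: "x = a + b" "a \<in> vec.span (V i)" "b \<in> vec.span (\<Union>i\<in>I. V i)"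
    unfolding vec.span_Un by blast
  obtain f where "\<forall>j\<in>I. f j \<in> vec.span (V j)" "b = sum f I" using insert.IH[OF ab(3)] by blast
  with ab insert.hyps show ?case
    by (intro exI[of _ "f(i := a)"]) (auto intro!: sum.cong)
qed simp

text \<open>The complex space of which \<^const>\<open>spectral_space\<close> is the set of real points.\<close>

definition modulus_space :: "real^'n^'n \<Rightarrow> nat \<Rightarrow> (complex^'n) set" where
  "modulus_space A i =
     vec.span (\<Union>z\<in>{z \<in> eigenvalues (transpose A). cmod z = modulus A i}. gen_eigenspace (transpose A) z)"

lemma spectral_space_iff: "v \<in> spectral_space A i \<longleftrightarrow> complexify v \<in> modulus_space A i"
  by (simp add: spectral_space_def modulus_space_def)

lemma gen_eigenspace_eq: "gen_eigenspace A z = gen_eig (map_matrix of_real A) z"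
  by (simp add: gen_eigenspace_def gen_eig_def)

lemma sum_over_moduli:
  fixes g :: "complex \<Rightarrow> 'a::comm_monoid_add"
  shows "(\<Sum>i\<in>{1..num_moduli A}. \<Sum>z\<in>{z \<in> eigenvalues (transpose A). cmod z = modulus A i}. g z)
       = (\<Sum>z\<in>eigenvalues (transpose A). g z)"
proof -
  have "(\<Sum>z\<in>eigenvalues A. g z) = (\<Sum>r\<in>cmod ` eigenvalues A. \<Sum>z\<in>{z \<in> eigenvalues A. cmod z = r}. g z)"
    by (rule sum.image_gen[OF finite_eigenvalues])
  then show ?thesis
    unfolding eigenvalues_transpose by (simp add: sum.reindex_bij_betw[OF modulus_bij, symmetric])
qed

lemma modulus_space_decomposition:
  "\<exists>f. (\<forall>i\<in>{1..num_moduli A}. f i \<in> modulus_space A i) \<and> w = sum f {1..num_moduli A}"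
proof -
  let ?L = "eigenvalues (transpose A)"
  have "(\<Union>y. gen_eigenspace (transpose A) y) \<subseteq> vec.span (\<Union>y\<in>?L. gen_eigenspace (transpose A) y)"
  proof
    fix x assume "x \<in> (\<Union>y. gen_eigenspace (transpose A) y)"
    then obtain y where y: "x \<in> gen_eigenspace (transpose A) y" by blast
    show "x \<in> vec.span (\<Union>y\<in>?L. gen_eigenspace (transpose A) y)"
    proof (cases "x = 0")
      case True
      then show ?thesis by (simp add: vec.span_zero)
    next
      case False
      then have "y \<in> ?L"
        using gen_eig_nontrivial y by (auto simp: gen_eigenspace_eq eigenvalues_def)
      then show ?thesis using y by (intro vec.span_base) blast
    qed
  qed
  then have "vec.span (\<Union>y\<in>?L. gen_eigenspace (transpose A) y) = UNIV"
    using gen_eig_span[of "map_matrix of_real (transpose A)"] vec.span_minimal vec.subspace_span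
    unfolding gen_eigenspace_eq by (metis top.extremum_unique)
  then have "w \<in> vec.span (\<Union>y\<in>?L. gen_eigenspace (transpose A) y)" by simp
  from span_UN_sum[OF finite_eigenvalues this]
  obtain g where g: "\<forall>z\<in>?L. g z \<in> vec.span (gen_eigenspace (transpose A) z)" "w = sum g ?L"
    by blast
  define f where "f i = (\<Sum>z\<in>{z \<in> ?L. cmod z = modulus A i}. g z)" for i
  have "w = sum f {1..num_moduli A}" unfolding f_def sum_over_moduli by (rule g(2))
  moreover have "f i \<in> modulus_space A i" for i
    unfolding f_def modulus_space_def
  proof (rule vec.span_sum)
    fix z assume z: "z \<in> {z \<in> ?L. cmod z = modulus A i}"
    have "vec.span (gen_eigenspace (transpose A) z)
        \<subseteq> vec.span (\<Union>z\<in>{z \<in> ?L. cmod z = modulus A i}. gen_eigenspace (transpose A) z)"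
      using z by (intro vec.span_mono) auto
    then show "g z \<in> vec.span (\<Union>z\<in>{z \<in> ?L. cmod z = modulus A i}. gen_eigenspace (transpose A) z)"
      using g(1) z by blast
  qed
  ultimately show ?thesis by blast
qed

lemma modulus_space_independent:
  assumes "\<And>i. i \<in> {1..num_moduli A} \<Longrightarrow> f i \<in> modulus_space A i"
    and "sum f {1..num_moduli A} = 0" and i: "i \<in> {1..num_moduli A}"
  shows "f i = 0"
proof -
  let ?L = "eigenvalues (transpose A)" and ?M = "map_matrix of_real (transpose A) :: complex^'a^'a"
  let ?Li = "\<lambda>i. {z \<in> ?L. cmod z = modulus A i}"
  have "\<exists>g. (\<forall>z\<in>?Li i. g z \<in> gen_eig ?M z) \<and> f i = sum g (?Li i)" if "i \<in> {1..num_moduli A}" for i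
  proof -
    have "f i \<in> vec.span (\<Union>z\<in>?Li i. gen_eig ?M z)"
      using assms(1)[OF that] by (simp add: modulus_space_def gen_eigenspace_eq)
    then show ?thesis
      using span_UN_sum[of "?Li i" "f i" "gen_eig ?M"] finite_eigenvalues[of "transpose A"]
      by (simp add: vec.span_eq_iff[THEN iffD2, OF subspace_gen_eig])
  qed
  then have "\<forall>i\<in>{1..num_moduli A}. \<exists>g. (\<forall>z\<in>?Li i. g z \<in> gen_eig ?M z) \<and> f i = sum g (?Li i)"
    by blast
  from bchoice[OF this]
  obtain g where g: "\<And>i z. i \<in> {1..num_moduli A} \<Longrightarrow> z \<in> ?Li i \<Longrightarrow> g i z \<in> gen_eig ?M z"
      "\<And>i. i \<in> {1..num_moduli A} \<Longrightarrow> f i = sum (g i) (?Li i)"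
    by blast
  define idx where "idx z = inv_into {1..num_moduli A} (modulus A) (cmod z)" for z
  have idx: "idx z = i" if "i \<in> {1..num_moduli A}" "z \<in> ?Li i" for i z
    using that modulus_bij[of A] inv_into_f_f[of "modulus A" "{1..num_moduli A}" i]
    by (auto simp: idx_def bij_betw_def)
  have idx': "idx z \<in> {1..num_moduli A}" "z \<in> ?Li (idx z)" if "z \<in> ?L" for z
  proof -
    have "cmod z \<in> modulus A ` {1..num_moduli A}"
      using that modulus_bij[of A] by (auto simp: bij_betw_def eigenvalues_transpose)
    then show "idx z \<in> {1..num_moduli A}" "z \<in> ?Li (idx z)"
      using that unfolding idx_def by (simp_all add: inv_into_into f_inv_into_f del: atLeastAtMost_iff)
  qed
  \<comment> \<open>The components of the \<open>f i\<close> belong to disjoint sets of eigenvalues and form one family.\<close>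
  define h where "h z = g (idx z) z" for z
  have "(\<Sum>z\<in>?L. h z) = (\<Sum>i\<in>{1..num_moduli A}. \<Sum>z\<in>?Li i. h z)"
    by (rule sum_over_moduli[symmetric])
  also have "\<dots> = sum f {1..num_moduli A}"
    by (intro sum.cong refl) (auto simp: g(2) h_def idx intro!: sum.cong)
  finally have sum0: "(\<Sum>z\<in>?L. h z) = 0" using assms(2) by simp
  have "h z = 0" if "z \<in> ?L" for z
    by (rule gen_eig_independent[OF finite_eigenvalues _ sum0 that, of ?M])
       (auto simp: h_def intro!: g(1)[OF idx'])
  then show ?thesis
    using g(2)[OF i] idx[OF i] unfolding h_def by (auto intro!: sum.neutral)
qed

definition cnj_vec :: "complex^'n \<Rightarrow> complex^'n" where
  "cnj_vec w = (\<chi> i. cnj (w $ i))"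

lemma cnj_vec_gen_eigenspace:
  assumes "w \<in> gen_eigenspace A z"
  shows "cnj_vec w \<in> gen_eigenspace A (cnj z)"
proof -
  have "cnj_vec ((map_matrix of_real A - mat z) *v u) = (map_matrix of_real A - mat (cnj z)) *v cnj_vec u"
    for u :: "complex^'a"
    by (auto simp: vec_eq_iff cnj_vec_def matrix_vector_mult_def mat_def intro!: sum.cong)
  then have pow: "(((*v) (map_matrix of_real A - mat (cnj z))) ^^ k) (cnj_vec w)
      = cnj_vec ((((*v) (map_matrix of_real A - mat z)) ^^ k) w)" for k
    by (induction k) auto
  have zero: "cnj_vec 0 = (0 :: complex^'a)" by (simp add: cnj_vec_def vec_eq_iff)
  obtain k where "(((*v) (map_matrix of_real A - mat z)) ^^ k) w = 0"
    using assms by (auto simp: gen_eigenspace_def)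
  then have "(((*v) (map_matrix of_real A - mat (cnj z))) ^^ k) (cnj_vec w) = 0"
    by (simp add: pow zero)
  then show ?thesis by (auto simp: gen_eigenspace_def)
qed

lemma eigenvalues_cnj:
  assumes "z \<in> eigenvalues A"
  shows "cnj z \<in> eigenvalues A"
proof -
  obtain v where v: "v \<noteq> 0" "map_matrix of_real A *v v = z *s v"
    using assms by (auto simp: eigenvalues_def)
  then have "cnj_vec (map_matrix of_real A *v v) = cnj_vec (z *s v)" by simp
  then have "map_matrix of_real A *v cnj_vec v = cnj z *s cnj_vec v"
    by (auto simp: vec_eq_iff cnj_vec_def matrix_vector_mult_def)
  moreover have "cnj_vec v \<noteq> 0" using v(1) by (auto simp: vec_eq_iff cnj_vec_def)
  ultimately show ?thesis by (auto simp: eigenvalues_def)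
qed

lemma modulus_space_cnj:
  assumes "w \<in> modulus_space A i"
  shows "cnj_vec w \<in> modulus_space A i"
  using assms unfolding modulus_space_def
proof (induction rule: vec.span_induct)
  case base
  have add: "cnj_vec (x + y) = cnj_vec x + cnj_vec y"
    and scale: "cnj_vec (c *s x) = cnj c *s cnj_vec x"
    and zero: "cnj_vec 0 = 0" for x y :: "complex^'a" and c
    by (auto simp: vec_eq_iff cnj_vec_def)
  show ?case
    by (rule vec.subspaceI) (auto simp: add scale zero vec.span_zero intro: vec.span_add vec.span_scale)
next
  case (step x)
  then obtain z where z: "z \<in> eigenvalues (transpose A)" "cmod z = modulus A i"
      "x \<in> gen_eigenspace (transpose A) z" by auto
  have "cnj_vec x \<in> gen_eigenspace (transpose A) (cnj z)" "cnj z \<in> eigenvalues (transpose A)"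
    using z cnj_vec_gen_eigenspace eigenvalues_cnj by blast+
  then show ?case using z(2) by (intro vec.span_base) (auto intro!: bexI[of _ "cnj z"])
qed

lemma complexify_sum: "complexify (sum f I) = (\<Sum>i\<in>I. complexify (f i))"
  by (simp add: vec_eq_iff complexify_def)

text \<open>The matrix is real, so complex conjugation permutes its eigenvalues without changing their
  moduli and preserves each complex space. By uniqueness of the decomposition the components of a
  real vector are then invariant under conjugation, that is, real.\<close>

lemma spectral_space_decomposition:
  "\<exists>f. (\<forall>i\<in>{1..num_moduli A}. f i \<in> spectral_space A i) \<and> sum f {1..num_moduli A} = \<eta>"
proof -
  obtain f where f: "\<forall>i\<in>{1..num_moduli A}. f i \<in> modulus_space A i"
      "complexify \<eta> = sum f {1..num_moduli A}"
    using modulus_space_decomposition by blast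
  have "f i - cnj_vec (f i) = 0" if "i \<in> {1..num_moduli A}" for i
  proof (rule modulus_space_independent[OF _ _ that, of "\<lambda>i. f i - cnj_vec (f i)"])
    show "f j - cnj_vec (f j) \<in> modulus_space A j" if "j \<in> {1..num_moduli A}" for j
      using f(1) that modulus_space_cnj[of "f j" A j] unfolding modulus_space_def
      by (intro vec.span_diff) auto
    have "(\<Sum>j\<in>{1..num_moduli A}. f j - cnj_vec (f j)) = complexify \<eta> - cnj_vec (complexify \<eta>)"
      unfolding f(2) by (simp add: sum_subtractf vec_eq_iff cnj_vec_def)
    then show "(\<Sum>j\<in>{1..num_moduli A}. f j - cnj_vec (f j)) = 0"
      by (simp add: cnj_vec_def complexify_def)
  qed
  then have real: "complexify (\<chi> k. Re (f i $ k)) = f i" if "i \<in> {1..num_moduli A}" for i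
    using that by (auto simp: vec_eq_iff complexify_def cnj_vec_def complex_eq_iff)
  define g where "g i = (\<chi> k. Re (f i $ k))" for i
  have "complexify (sum g {1..num_moduli A}) = complexify \<eta>"
    unfolding complexify_sum f(2) by (intro sum.cong refl) (simp add: g_def real)
  then have "sum g {1..num_moduli A} = \<eta>" by (simp add: complexify_def vec_eq_iff del: of_real_sum flip: of_real_sum)
  moreover have "g i \<in> spectral_space A i" if "i \<in> {1..num_moduli A}" for i
    using real[OF that] f(1) that by (simp add: spectral_space_iff g_def)
  ultimately show ?thesis by blast
qed

lemma subspace_spectral_space: "subspace (spectral_space A i)"
proof (rule subspaceI)
  have "complexify (0 :: real^'a) = 0" "complexify (x + y) = complexify x + complexify y"
    "complexify (c *\<^sub>R x) = of_real c *s complexify x" for x y :: "real^'a" and c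
    by (auto simp: vec_eq_iff complexify_def)
  then show "0 \<in> spectral_space A i"
    "x \<in> spectral_space A i \<Longrightarrow> y \<in> spectral_space A i \<Longrightarrow> x + y \<in> spectral_space A i"
    "x \<in> spectral_space A i \<Longrightarrow> c *\<^sub>R x \<in> spectral_space A i" for x y c
    unfolding spectral_space_iff modulus_space_def
    by (auto intro: vec.span_zero vec.span_add vec.span_scale)
qed

lemma spectral_space_independent:
  assumes "\<And>i. i \<in> {1..num_moduli A} \<Longrightarrow> f i \<in> spectral_space A i"
    and "sum f {1..num_moduli A} = 0" and i: "i \<in> {1..num_moduli A}"
  shows "f i = 0"
proof -
  have "complexify (f i) = 0"
  proof (rule modulus_space_independent[OF _ _ i])
    show "(\<Sum>j\<in>{1..num_moduli A}. complexify (f j)) = 0"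
      using assms(2) unfolding complexify_sum[symmetric] by (simp add: complexify_def vec_eq_iff)
  qed (use assms(1) in \<open>auto simp: spectral_space_iff\<close>)
  then show ?thesis by (simp add: complexify_def vec_eq_iff)
qed

lemma spectral_proj_sum:
  assumes "\<And>j. j \<in> {1..num_moduli A} \<Longrightarrow> f j \<in> spectral_space A j" and i: "i \<in> {1..num_moduli A}"
  shows "spectral_proj A i (sum f {1..num_moduli A}) = f i"
  unfolding spectral_proj_def
proof (rule the_equality)
  fix w assume "\<exists>g. (\<forall>j\<in>{1..num_moduli A}. g j \<in> spectral_space A j) \<and>
      (\<Sum>j\<in>{1..num_moduli A}. g j) = sum f {1..num_moduli A} \<and> w = g i"
  then obtain g where g: "\<forall>j\<in>{1..num_moduli A}. g j \<in> spectral_space A j"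
      "(\<Sum>j\<in>{1..num_moduli A}. g j) = sum f {1..num_moduli A}" "w = g i" by blast
  have "g i - f i = 0"
    by (rule spectral_space_independent[OF _ _ i, of "\<lambda>i. g i - f i"])
       (use g assms(1) in \<open>auto simp: sum_subtractf intro: subspace_diff subspace_spectral_space\<close>)
  then show "w = f i" using g(3) by simp
qed (use assms(1) in \<open>auto intro!: exI[of _ f]\<close>)

lemma linear_spectral_proj:
  assumes "i \<in> {1..num_moduli A}"
  shows "linear (spectral_proj A i)"
proof (rule linearI)
  fix x y
  obtain f where f: "\<forall>i\<in>{1..num_moduli A}. f i \<in> spectral_space A i" "sum f {1..num_moduli A} = x"
    using spectral_space_decomposition by blast
  obtain g where g: "\<forall>i\<in>{1..num_moduli A}. g i \<in> spectral_space A i" "sum g {1..num_moduli A} = y"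
    using spectral_space_decomposition by blast
  have "spectral_proj A i (\<Sum>j\<in>{1..num_moduli A}. f j + g j) = f i + g i"
    by (rule spectral_proj_sum[OF _ assms])
       (use f g in \<open>auto intro: subspace_add subspace_spectral_space\<close>)
  then show "spectral_proj A i (x + y) = spectral_proj A i x + spectral_proj A i y"
    using f g spectral_proj_sum[OF _ assms, of f] spectral_proj_sum[OF _ assms, of g]
    by (auto simp: sum.distrib)
next
  fix c x
  obtain f where f: "\<forall>i\<in>{1..num_moduli A}. f i \<in> spectral_space A i" "sum f {1..num_moduli A} = x"
    using spectral_space_decomposition by blast
  have "spectral_proj A i (\<Sum>j\<in>{1..num_moduli A}. c *\<^sub>R f j) = c *\<^sub>R f i"
    by (rule spectral_proj_sum[OF _ assms])
       (use f in \<open>auto intro: subspace_scale subspace_spectral_space\<close>)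
  then show "spectral_proj A i (c *\<^sub>R x) = c *\<^sub>R spectral_proj A i x"
    using f spectral_proj_sum[OF _ assms, of f] by (auto simp: scaleR_sum_right)
qed

lemma spectral_proj_id:
  assumes i: "i \<in> {1..num_moduli A}" and v: "v \<in> spectral_space A i"
  shows "spectral_proj A i v = v"
proof -
  have "spectral_proj A i (\<Sum>j\<in>{1..num_moduli A}. if j = i then v else 0) = (if i = i then v else 0)"
    by (rule spectral_proj_sum[OF _ i]) (use v subspace_0[OF subspace_spectral_space] in auto)
  then show ?thesis using i by simp
qed

text \<open>The kernel of the projection is a proper subspace, because the projection is the identity on
  its nonzero range. Off these kernels the conventional value \<open>0 powr a = 0\<close> in the weight does not
  occur.\<close>

lemma spectral_proj_nonzero_AE:
  fixes A :: "real^'n^'n"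
  assumes i: "i \<in> {1..num_moduli A}" and d: "dim (spectral_space A i) > 0"
  shows "AE \<eta> in lborel. spectral_proj A i \<eta> \<noteq> 0"
proof -
  let ?K = "{\<eta>. spectral_proj A i \<eta> = 0}"
  have lin: "linear (spectral_proj A i)" by (rule linear_spectral_proj[OF i])
  obtain v where v: "v \<in> spectral_space A i" "v \<noteq> 0"
    using d by (metis dim_eq_0 less_irrefl subsetI singleton_iff)
  have sub: "subspace ?K" by (rule linear_subspace_kernel[OF lin])
  have "v \<notin> ?K" using spectral_proj_id[OF i v(1)] v(2) by simp
  then have "?K \<noteq> UNIV" by blast
  then have "dim ?K < DIM(real^'n)"
    using sub by (metis dim_eq_full dim_subset_UNIV le_neq_implies_less span_eq_iff)
  then have "?K \<in> null_sets lebesgue"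
    using negligible_lowdim negligible_iff_null_sets by blast
  moreover have "?K \<in> sets lborel"
    using closed_subspace[OF sub] by simp
  ultimately have "?K \<in> null_sets lborel" by (simp add: null_sets_completion_iff)
  then show ?thesis by (rule AE_I') auto
qed

section \<open>The coding of the fibre measures\<close>

text \<open>The inverse branches in closed form: each step prepends the letter \<open>a n\<close> to the expansion
  in base \<open>l\<close>. Unlike the definite description in \<^const>\<open>inv_branch\<close>, this is visibly measurable.\<close>

primrec branch :: "nat \<Rightarrow> (nat \<Rightarrow> nat) \<Rightarrow> nat \<Rightarrow> real \<Rightarrow> real" where
  "branch l a 0 x = x"
| "branch l a (Suc n) x = (branch l a n x + (real (a n) - 1)) / real l"

lemma tau_on_cell:
  assumes "0 < l" "1 \<le> k" "k \<le> l" "z \<in> cell l k"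
  shows "tau l z = real l * z - (real k - 1)" "tau l z \<in> {0..<1}" "z \<in> {0..<1}"
proof -
  have b: "real k - 1 \<le> real l * z" "real l * z < real k"
    using assms by (auto simp: cell_def field_simps)
  have "\<lfloor>real l * z\<rfloor> = int k - 1" using b by (intro floor_unique) auto
  then show *: "tau l z = real l * z - (real k - 1)" by (simp add: tau_def frac_def)
  show "tau l z \<in> {0..<1}" unfolding * using b by auto
  have "0 \<le> (real k - 1) / real l" "real k / real l \<le> 1" using assms by auto
  then show "z \<in> {0..<1}" using assms(4) unfolding cell_def by auto
qed

text \<open>A point of a cylinder visits the cells of the prefix in reverse order, so the newest letter
  \<open>a n\<close> governs the point itself and the older ones its image.\<close>

lemma cylinder_Suc:
  assumes "0 < l" "1 \<le> a n" "a n \<le> l"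
  shows "z \<in> cylinder l a (Suc n) \<longleftrightarrow> z \<in> cell l (a n) \<and> tau l z \<in> cylinder l a n"
proof -
  have "(\<forall>j<Suc n. (tau l ^^ j) z \<in> cell l (a (Suc n - j - 1)))
      \<longleftrightarrow> z \<in> cell l (a n) \<and> (\<forall>j<n. (tau l ^^ j) (tau l z) \<in> cell l (a (n - j - 1)))"
    by (auto simp: All_less_Suc2 funpow_swap1)
  then show ?thesis
    using tau_on_cell[OF assms(1-3), of z] unfolding cylinder_def by auto
qed

lemma branch_unique:
  assumes l: "0 < l" and a: "\<And>i. a i \<in> {1..l}" and x: "x \<in> {0..<1}"
  shows "z \<in> cylinder l a n \<and> (tau l ^^ n) z = x \<longleftrightarrow> z = branch l a n x"
proof (induction n arbitrary: z)
  case 0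
  then show ?case using x by (auto simp: cylinder_def)
next
  case (Suc n)
  have an: "1 \<le> a n" "a n \<le> l" using a[of n] by auto
  have "branch l a n x \<in> cylinder l a n" using Suc.IH[of "branch l a n x"] by simp
  then have b: "branch l a n x \<in> {0..<1}" by (auto simp: cylinder_def)
  have "z \<in> cylinder l a (Suc n) \<and> (tau l ^^ Suc n) z = x
      \<longleftrightarrow> z \<in> cell l (a n) \<and> (tau l z \<in> cylinder l a n \<and> (tau l ^^ n) (tau l z) = x)"
    unfolding cylinder_Suc[of l a n, OF l an] by (simp add: funpow_swap1 conj_assoc)
  also have "\<dots> \<longleftrightarrow> z \<in> cell l (a n) \<and> tau l z = branch l a n x"
    unfolding Suc.IH ..
  also have "\<dots> \<longleftrightarrow> z = branch l a (Suc n) x"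
  proof
    assume "z \<in> cell l (a n) \<and> tau l z = branch l a n x"
    then show "z = branch l a (Suc n) x"
      using tau_on_cell(1)[OF l an, of z] l by (auto simp: field_simps)
  next
    assume z: "z = branch l a (Suc n) x"
    then have c: "z \<in> cell l (a n)" using b l by (auto simp: cell_def field_simps)
    have "tau l z = branch l a n x"
      unfolding tau_on_cell(1)[OF l an c] using z l by (simp add: field_simps)
    with c show "z \<in> cell l (a n) \<and> tau l z = branch l a n x" ..
  qed
  finally show ?case .
qed

lemma inv_branch_eq:
  assumes "0 < l" "\<And>i. a i \<in> {1..l}" "x \<in> {0..<1}"
  shows "inv_branch l a n x = branch l a n x"
  unfolding inv_branch_def branch_unique[OF assms] by simp

lemma prob_space_bernoulli_measure: "0 < l \<Longrightarrow> prob_space (bernoulli_measure l)"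
  unfolding bernoulli_measure_def
  by (intro prob_space_PiM prob_space_uniform_count_measure) auto

lemma space_bernoulli_measure: "space (bernoulli_measure l) = {a. \<forall>i. a i \<in> {1..l}}"
  by (auto simp: bernoulli_measure_def space_PiM space_uniform_count_measure PiE_def Pi_def)

lemma sigma_finite_circle_measure: "sigma_finite_measure circle_measure"
  unfolding circle_measure_def by (intro sigma_finite_measure_restrict_space sigma_finite_lborel) auto

lemma space_circle_measure [simp]: "space circle_measure = {0..<1}"
  by (simp add: circle_measure_def space_restrict_space)

lemma C_circle_continuous: "C_circle r \<phi> \<Longrightarrow> continuous_on UNIV \<phi>"
  unfolding C_circle_def by (metis le0)

text \<open>Joint measurability is what gives \<^const>\<open>srb_measure\<close> its meaning as an image measure.\<close>

lemma measurable_S_sum: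
  fixes A :: "real^'n^'n"
  assumes l: "0 < l" and \<phi>: "C_circle r \<phi>"
  shows "(\<lambda>(x, a). S_sum l A \<phi> x a) \<in> borel_measurable (circle_measure \<Otimes>\<^sub>M bernoulli_measure l)"
proof -
  have [measurable]: "\<phi> \<in> borel_measurable borel"
    using C_circle_continuous[OF \<phi>] by (rule borel_measurable_continuous_onI)
  have [measurable]: "(\<lambda>x. x) \<in> borel_measurable circle_measure"
    unfolding circle_measure_def by (intro measurable_restrict_space1) simp
  have [measurable]: "(\<lambda>a. real (a n)) \<in> borel_measurable (bernoulli_measure l)" for n
  proof -
    have "(\<lambda>a. a n) \<in> measurable (bernoulli_measure l) (uniform_count_measure {1..l})"
      unfolding bernoulli_measure_def by (rule measurable_component_singleton) simp
    moreover have "real \<in> borel_measurable (uniform_count_measure {1..l})"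
      by (simp add: measurable_def uniform_count_measure_def space_point_measure sets_point_measure)
    ultimately show ?thesis by (rule measurable_compose)
  qed
  have [measurable]: "(\<lambda>p. branch l (snd p) n (fst p)) \<in> borel_measurable (circle_measure \<Otimes>\<^sub>M bernoulli_measure l)" for n
    by (induction n) simp_all
  have "bounded_linear (\<lambda>v. (((*v) A) ^^ j) v)" for j
    by (induction j)
       (simp_all add: bounded_linear_ident bounded_linear_compose[OF matrix_vector_mul_bounded_linear])
  then have pow: "(\<lambda>v. (((*v) A) ^^ j) v) \<in> borel_measurable borel" for j
    by (intro borel_measurable_continuous_onI linear_continuous_on)
  have "(\<lambda>p. \<phi> (branch l (snd p) (Suc j) (fst p)))
      \<in> borel_measurable (circle_measure \<Otimes>\<^sub>M bernoulli_measure l)" for j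
    by measurable
  then have "(\<lambda>p. \<Sum>j. (((*v) A) ^^ j) (\<phi> (branch l (snd p) (Suc j) (fst p))))
      \<in> borel_measurable (circle_measure \<Otimes>\<^sub>M bernoulli_measure l)"
    by (intro borel_measurable_suminf measurable_compose[OF _ pow])
  then show ?thesis
    by (rule measurable_cong[THEN iffD1, rotated])
       (auto simp: S_sum_def space_pair_measure space_bernoulli_measure inv_branch_eq[OF l])
qed

lemma measurable_S_sum_fibre:
  assumes "0 < l" "C_circle r \<phi>" "x \<in> {0..<1}"
  shows "S_sum l A \<phi> x \<in> borel_measurable (bernoulli_measure l)"
proof -
  have "(\<lambda>a. (case (x, a) of (x, a) \<Rightarrow> S_sum l A \<phi> x a)) \<in> borel_measurable (bernoulli_measure l)"
    using assms by (intro measurable_compose[OF _ measurable_S_sum]) (auto simp: circle_measure_def[symmetric])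
  then show ?thesis by simp
qed

lemma prob_space_srb_fibre:
  assumes "0 < l" "C_circle r \<phi>" "x \<in> {0..<1}"
  shows "prob_space (srb_fibre l A \<phi> x)"
  unfolding srb_fibre_def
  by (intro prob_space.prob_space_distr prob_space_bernoulli_measure measurable_S_sum_fibre[OF assms] assms(1))

lemma disintegration_srb_fibre:
  assumes l: "0 < l" and \<phi>: "C_circle r \<phi>"
  shows "disintegration (srb_measure l A \<phi>) (srb_fibre l A \<phi>)"
proof -
  let ?\<nu> = "bernoulli_measure l"
  interpret \<nu>: prob_space ?\<nu> by (rule prob_space_bernoulli_measure[OF l])
  note [measurable] = measurable_S_sum[OF l \<phi>, of A]
  have P [measurable]: "(\<lambda>(x, a). (x, S_sum l A \<phi> x a))
      \<in> measurable (circle_measure \<Otimes>\<^sub>M ?\<nu>) (circle_measure \<Otimes>\<^sub>M borel)"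
    by measurable
  have sec: "emeasure (srb_fibre l A \<phi> x) B = emeasure ?\<nu> (Pair x -` ({p \<in> space (circle_measure \<Otimes>\<^sub>M ?\<nu>). (case p of (x, a) \<Rightarrow> S_sum l A \<phi> x a) \<in> B}))"
    if "x \<in> {0..<1}" "B \<in> sets borel" for x B
    unfolding srb_fibre_def
    using that by (subst emeasure_distr[OF measurable_S_sum_fibre[OF l \<phi>]])
       (auto intro!: arg_cong[where f = "emeasure ?\<nu>"] simp: space_pair_measure)
  have "(\<lambda>x. emeasure (srb_fibre l A \<phi> x) B) \<in> borel_measurable circle_measure" if [measurable]: "B \<in> sets borel" for B
  proof -
    have "(\<lambda>x. emeasure ?\<nu> (Pair x -` ({p \<in> space (circle_measure \<Otimes>\<^sub>M ?\<nu>). (case p of (x, a) \<Rightarrow> S_sum l A \<phi> x a) \<in> B})))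
        \<in> borel_measurable circle_measure"
      by (rule \<nu>.measurable_emeasure_Pair) measurable
    then show ?thesis
      by (rule measurable_cong[THEN iffD1, rotated]) (simp add: sec that)
  qed
  moreover have "emeasure (srb_measure l A \<phi>) C
      = (\<integral>\<^sup>+x. emeasure (srb_fibre l A \<phi> x) (Pair x -` C) \<partial>circle_measure)"
    if C: "C \<in> sets (circle_measure \<Otimes>\<^sub>M borel)" for C
  proof -
    let ?T = "(\<lambda>(x, a). (x, S_sum l A \<phi> x a)) -` C \<inter> space (circle_measure \<Otimes>\<^sub>M ?\<nu>)"
    have "emeasure (srb_measure l A \<phi>) C = emeasure (circle_measure \<Otimes>\<^sub>M ?\<nu>) ?T"
      unfolding srb_measure_def by (rule emeasure_distr[OF P C])
    also have "\<dots> = (\<integral>\<^sup>+x. emeasure ?\<nu> (Pair x -` ?T) \<partial>circle_measure)"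
      by (rule \<nu>.emeasure_pair_measure_alt) (rule measurable_sets[OF P C])
    also have "\<dots> = (\<integral>\<^sup>+x. emeasure (srb_fibre l A \<phi> x) (Pair x -` C) \<partial>circle_measure)"
    proof (rule nn_integral_cong)
      fix x assume "x \<in> space circle_measure"
      then have x: "x \<in> {0..<1}" by simp
      have "Pair x -` C \<in> sets borel" by (rule sets_Pair1[OF C])
      then show "emeasure ?\<nu> (Pair x -` ?T) = emeasure (srb_fibre l A \<phi> x) (Pair x -` C)"
        unfolding srb_fibre_def using x
        by (subst emeasure_distr[OF measurable_S_sum_fibre[OF l \<phi>]])
           (auto intro!: arg_cong[where f = "emeasure ?\<nu>"] simp: space_pair_measure)
    qed
    finally show ?thesis .
  qed
  moreover have "finite_measure (srb_fibre l A \<phi> x)" if "x \<in> {0..<1}" for x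
    using prob_space_srb_fibre[OF l \<phi> that] by (rule prob_space.finite_measure)
  ultimately show ?thesis
    unfolding disintegration_def by (auto simp: srb_measure_def srb_fibre_def)
qed

text \<open>The membership condition speaks of some disintegration, the conclusion of the specific
  measures \<^const>\<open>srb_fibre\<close>. Fibre measures are determined on each single Borel set outside a null
  set of base points; a countable generator closed under finite intersections makes one null set
  suffice for all Borel sets.\<close>

lemma disintegration_unique:
  fixes \<mu> :: "(real \<times> (real^'n)) measure"
  assumes \<kappa>: "disintegration \<mu> \<kappa>" and \<kappa>': "disintegration \<mu> \<kappa>'"
  shows "AE x in circle_measure. \<kappa> x = \<kappa>' x"
proof -
  interpret sigma_finite_measure circle_measure by (rule sigma_finite_circle_measure)
  obtain B :: "(real^'n) set set" where B: "countable B" "topological_basis B"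
    using ex_countable_basis by blast
  \<comment> \<open>The empty family contributes the whole space, which the generator must contain.\<close>
  define P where "P = Inter ` {F. F \<subseteq> B \<and> finite F}"
  have "countable P" unfolding P_def
    using countable_Collect_finite_subset[OF B(1)] by (simp add: conj_commute)
  have P_borel: "P \<subseteq> sets borel"
    using B(2) by (auto simp: P_def topological_basis_open intro!: borel_open open_Inter)
  have "B \<subseteq> P" unfolding P_def by (auto intro!: image_eqI[of _ _ "{_}"])
  have "UNIV \<in> P" unfolding P_def by (auto intro!: image_eqI[of _ _ "{}"])
  have "Int_stable P"
    unfolding P_def Int_stable_def
    by (auto simp: Inter_Un_distrib[symmetric] intro!: image_eqI[OF refl])
  have borel: "sets borel = sigma_sets UNIV P"
  proof
    have "sets borel = sets (sigma UNIV B)"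
      by (simp only: borel_eq_countable_basis[OF B])
    then have "sets borel = sigma_sets UNIV B"
      by (simp add: sets_measure_of)
    then show "sets borel \<subseteq> sigma_sets UNIV P" using \<open>B \<subseteq> P\<close> sigma_sets_mono' by metis
    show "sigma_sets UNIV P \<subseteq> sets borel" using P_borel sets.sigma_sets_subset[of P borel] by simp
  qed
  have "AE x in circle_measure. emeasure (\<kappa> x) C = emeasure (\<kappa>' x) C" if "C \<in> P" for C
  proof (rule density_unique2)
    have C: "C \<in> sets borel" using that P_borel by blast
    show "(\<lambda>x. emeasure (\<kappa> x) C) \<in> borel_measurable circle_measure"
      "(\<lambda>x. emeasure (\<kappa>' x) C) \<in> borel_measurable circle_measure"
      using C \<kappa> \<kappa>' by (auto simp: disintegration_def)
    fix E assume E: "E \<in> sets circle_measure"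
    have EC: "E \<times> C \<in> sets \<mu>" using E C \<kappa> by (simp add: disintegration_def)
    have "(\<integral>\<^sup>+x\<in>E. emeasure (\<kappa> x) C \<partial>circle_measure) = emeasure \<mu> (E \<times> C)" if "disintegration \<mu> \<kappa>" for \<kappa>
    proof -
      have "emeasure \<mu> (E \<times> C) = (\<integral>\<^sup>+x. emeasure (\<kappa> x) (Pair x -` (E \<times> C)) \<partial>circle_measure)"
        using EC that by (simp add: disintegration_def)
      also have "\<dots> = (\<integral>\<^sup>+x\<in>E. emeasure (\<kappa> x) C \<partial>circle_measure)"
        by (intro nn_integral_cong) (auto split: split_indicator)
      finally show ?thesis by simp
    qed
    from this[OF \<kappa>] this[OF \<kappa>']
    show "(\<integral>\<^sup>+x\<in>E. emeasure (\<kappa> x) C \<partial>circle_measure) = (\<integral>\<^sup>+x\<in>E. emeasure (\<kappa>' x) C \<partial>circle_measure)"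
      by simp
  qed
  then have "AE x in circle_measure. \<forall>C\<in>P. emeasure (\<kappa> x) C = emeasure (\<kappa>' x) C"
    using \<open>countable P\<close> by (simp add: AE_ball_countable)
  then show ?thesis
  proof (rule AE_mp, intro AE_I2 impI)
    fix x assume x: "x \<in> space circle_measure" and eq: "\<forall>C\<in>P. emeasure (\<kappa> x) C = emeasure (\<kappa>' x) C"
    have s: "sets (\<kappa> x) = sets borel" "sets (\<kappa>' x) = sets borel" "finite_measure (\<kappa> x)"
      using x \<kappa> \<kappa>' by (auto simp: disintegration_def)
    show "\<kappa> x = \<kappa>' x"
      by (rule measure_eqI_generator_eq[OF \<open>Int_stable P\<close>, of UNIV _ _ "\<lambda>_. UNIV"])
         (use s eq borel \<open>UNIV \<in> P\<close> in \<open>auto simp: finite_measure.emeasure_finite\<close>)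
  qed
qed

section \<open>Correlation integrals and the Fourier transform\<close>

lemma cis_measurable [measurable]: "cis \<in> borel_measurable borel"
  by (intro borel_measurable_continuous_onI continuous_intros)

lemma normal_density_fourier:
  assumes "0 < \<sigma>"
  shows "(LINT x|lborel. complex_of_real (normal_density 0 \<sigma> x) * cis (t * x)) = of_real (exp (- (\<sigma> * t)\<^sup>2 / 2))"
proof -
  have std: "(LINT x|lborel. complex_of_real (std_normal_density x) * cis (u * x)) = of_real (exp (- u\<^sup>2 / 2))" for u
  proof -
    have "char std_normal_distribution u = of_real (exp (- u\<^sup>2 / 2))"
      using char_std_normal_distribution by (simp add: fun_eq_iff)
    moreover have "char std_normal_distribution u = (LINT x|lborel. std_normal_density x *\<^sub>R iexp (u * x))"
      unfolding char_def by (rule integral_density) auto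
    ultimately show ?thesis by (simp add: cis_conv_exp scaleR_conv_of_real)
  qed
  have dens: "normal_density 0 \<sigma> (\<sigma> * x) = std_normal_density x / \<sigma>" for x
    using assms by (simp add: normal_density_def power_mult_distrib real_sqrt_mult field_simps)
  have "(LINT x|lborel. complex_of_real (normal_density 0 \<sigma> x) * cis (t * x))
      = \<bar>\<sigma>\<bar> *\<^sub>R (LINT x|lborel. complex_of_real (normal_density 0 \<sigma> (0 + \<sigma> * x)) * cis (t * (0 + \<sigma> * x)))"
    using assms by (intro lborel_integral_real_affine) auto
  also have "\<dots> = (LINT x|lborel. complex_of_real (std_normal_density x) * cis ((\<sigma> * t) * x))"
    unfolding integral_scaleR_right[symmetric] add_0 dens using assms
    by (intro Bochner_Integration.integral_cong refl) (simp add: scaleR_conv_of_real mult_ac)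
  finally show ?thesis by (simp add: std)
qed

text \<open>The density of the centred normal law on a Euclidean space with covariance \<open>\<sigma>\<^sup>2\<close> times the
  identity.\<close>

definition gauss :: "real \<Rightarrow> 'a::euclidean_space \<Rightarrow> real" where
  "gauss \<sigma> \<eta> = (\<Prod>b\<in>Basis. normal_density 0 \<sigma> (\<eta> \<bullet> b))"

lemma gauss_nonneg: "0 \<le> gauss \<sigma> \<eta>"
  by (simp add: gauss_def prod_nonneg)

lemma gauss_measurable [measurable]: "gauss \<sigma> \<in> borel_measurable borel"
  unfolding gauss_def[abs_def] by measurable

lemma gauss_eq:
  fixes \<eta> :: "'a::euclidean_space"
  assumes "0 < \<sigma>"
  shows "gauss \<sigma> \<eta> = (1 / (sqrt (2 * pi) * \<sigma>)) ^ DIM('a) * exp (- (norm \<eta>)\<^sup>2 / (2 * \<sigma>\<^sup>2))"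
proof -
  have "gauss \<sigma> \<eta> = (\<Prod>b\<in>Basis. 1 / (sqrt (2 * pi) * \<sigma>) * exp (- (\<eta> \<bullet> b)\<^sup>2 / (2 * \<sigma>\<^sup>2)))"
    using assms by (simp add: gauss_def normal_density_def real_sqrt_mult)
  also have "\<dots> = (1 / (sqrt (2 * pi) * \<sigma>)) ^ DIM('a) * exp (\<Sum>b\<in>(Basis::'a set). - (\<eta> \<bullet> b)\<^sup>2 / (2 * \<sigma>\<^sup>2))"
    by (simp only: prod.distrib exp_sum[OF finite_Basis] prod_constant)
  also have "(\<Sum>b\<in>(Basis::'a set). - (\<eta> \<bullet> b)\<^sup>2 / (2 * \<sigma>\<^sup>2)) = - (norm \<eta>)\<^sup>2 / (2 * \<sigma>\<^sup>2)"
    unfolding power2_norm_eq_inner euclidean_inner[of \<eta> \<eta>]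
    by (simp add: sum_divide_distrib sum_negf power2_eq_square)
  finally show ?thesis .
qed

lemma gauss_integrable: "0 < \<sigma> \<Longrightarrow> integrable lborel (gauss \<sigma> :: 'a::euclidean_space \<Rightarrow> real)"
proof (rule integrableI_nonneg)
  assume \<sigma>: "0 < \<sigma>"
  have "(\<integral>\<^sup>+\<eta>. ennreal (gauss \<sigma> \<eta>) \<partial>(lborel :: 'a measure))
      = (\<integral>\<^sup>+\<eta>. (\<Prod>b\<in>Basis. ennreal (normal_density 0 \<sigma> (\<eta> \<bullet> b))) \<partial>(lborel :: 'a measure))"
    by (simp add: gauss_def prod_ennreal)
  also have "\<dots> = (\<Prod>b\<in>(Basis::'a set). \<integral>\<^sup>+x. ennreal (normal_density 0 \<sigma> x) \<partial>lborel)"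
    by (rule nn_integral_lborel_prod) auto
  also have "\<dots> = 1"
    using \<sigma> by (simp add: nn_integral_eq_integral)
  finally show "(\<integral>\<^sup>+\<eta>. ennreal (gauss \<sigma> \<eta>) \<partial>(lborel :: 'a measure)) < \<infinity>" by simp
qed (auto simp: gauss_nonneg)

lemma gauss_fourier:
  fixes v :: "'a::euclidean_space"
  assumes \<sigma>: "0 < \<sigma>"
  shows "(LINT \<eta>|lborel. complex_of_real (gauss \<sigma> \<eta>) * cis (t * (\<eta> \<bullet> v))) = of_real (exp (- (\<sigma> * t * norm v)\<^sup>2 / 2))"
proof -
  interpret product_sigma_finite "\<lambda>_ :: 'a. lborel :: real measure" ..
  let ?f = "\<lambda>b x. complex_of_real (normal_density 0 \<sigma> x) * cis ((t * (v \<bullet> b)) * x)"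
  have int: "integrable lborel (?f b)" for b
    by (rule Bochner_Integration.integrable_bound[OF integrable_normal_density[OF \<sigma>, of 0]])
       (auto simp: norm_mult)
  have f: "complex_of_real (gauss \<sigma> \<eta>) * cis (t * (\<eta> \<bullet> v)) = (\<Prod>b\<in>Basis. ?f b (\<eta> \<bullet> b))" for \<eta> :: 'a
  proof -
    have "cis (t * (\<eta> \<bullet> v)) = exp (\<Sum>b\<in>(Basis::'a set). \<i> * complex_of_real ((t * (v \<bullet> b)) * (\<eta> \<bullet> b)))"
      unfolding cis_conv_exp euclidean_inner[of \<eta> v] by (simp add: sum_distrib_left mult_ac)
    also have "\<dots> = (\<Prod>b\<in>(Basis::'a set). cis ((t * (v \<bullet> b)) * (\<eta> \<bullet> b)))"
      by (simp only: exp_sum[OF finite_Basis] cis_conv_exp)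
    finally show ?thesis by (simp add: gauss_def prod.distrib)
  qed
  have "(LINT \<eta>|lborel. complex_of_real (gauss \<sigma> \<eta>) * cis (t * (\<eta> \<bullet> v)))
      = (LINT x|(\<Pi>\<^sub>M b\<in>(Basis::'a set). lborel). (\<Prod>b\<in>Basis. ?f b ((\<Sum>c\<in>Basis. x c *\<^sub>R c) \<bullet> b)))"
    unfolding f by (subst lborel_eq, rule integral_distr) measurable
  also have "\<dots> = (LINT x|(\<Pi>\<^sub>M b\<in>(Basis::'a set). lborel). (\<Prod>b\<in>Basis. ?f b (x b)))"
    by (intro Bochner_Integration.integral_cong prod.cong refl) simp
  also have "\<dots> = (\<Prod>b\<in>(Basis::'a set). LINT x|lborel. ?f b x)"
    by (rule product_integral_prod[OF finite_Basis int])
  also have "\<dots> = (\<Prod>b\<in>(Basis::'a set). of_real (exp (- (\<sigma> * (t * (v \<bullet> b)))\<^sup>2 / 2)))"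
    by (simp only: normal_density_fourier[OF \<sigma>])
  also have "\<dots> = of_real (exp (\<Sum>b\<in>(Basis::'a set). - (\<sigma> * (t * (v \<bullet> b)))\<^sup>2 / 2))"
    by (simp only: exp_sum[OF finite_Basis] of_real_prod)
  also have "(\<Sum>b\<in>(Basis::'a set). - (\<sigma> * (t * (v \<bullet> b)))\<^sup>2 / 2) = - (\<sigma> * t * norm v)\<^sup>2 / 2"
    unfolding power_mult_distrib power2_norm_eq_inner euclidean_inner[of v v]
    by (simp add: sum_distrib_left sum_divide_distrib sum_negf[symmetric] power2_eq_square mult_ac)
  finally show ?thesis .
qed

text \<open>The square of the modulus of the Fourier transform is the Fourier transform of the
  autocorrelation of \<open>\<mu>\<close>. Integrated against a Gaussian in the frequency it becomes, by Fubini, the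
  double integral of a Gaussian in the distance of two independent points.\<close>

lemma fourier_gauss_identity:
  fixes \<mu> :: "(real^'n) measure"
  assumes prob: "prob_space \<mu>" and sets [measurable_cong]: "sets \<mu> = sets borel" and \<sigma>: "0 < \<sigma>"
  shows "(\<integral>\<^sup>+\<eta>. ennreal (gauss \<sigma> \<eta> * (cmod (fourier_measure \<mu> \<eta>))\<^sup>2) \<partial>lborel)
       = (\<integral>\<^sup>+p. ennreal (exp (- (\<sigma> * (2 * pi) * norm (fst p - snd p))\<^sup>2 / 2)) \<partial>(\<mu> \<Otimes>\<^sub>M \<mu>))"
proof -
  interpret \<mu>: prob_space \<mu> by fact
  interpret \<mu>\<mu>: pair_prob_space \<mu> \<mu> ..
  interpret L: pair_sigma_finite "lborel :: (real^'n) measure" "\<mu> \<Otimes>\<^sub>M \<mu>" ..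
  have F [measurable]: "fourier_measure \<mu> \<in> borel_measurable borel"
    unfolding fourier_measure_def[abs_def] by measurable
  have sq: "of_real ((cmod (fourier_measure \<mu> \<eta>))\<^sup>2) = (LINT p|(\<mu> \<Otimes>\<^sub>M \<mu>). cis (2 * pi * (\<eta> \<bullet> (fst p - snd p))))" for \<eta>
  proof -
    have cis_split: "cis (2 * pi * (\<eta> \<bullet> (y - z))) = cis (2 * pi * (\<eta> \<bullet> y)) * cis (- (2 * pi * (\<eta> \<bullet> z)))" for y z
      by (simp add: cis_mult inner_diff_right right_diff_distrib)
    have "of_real ((cmod (fourier_measure \<mu> \<eta>))\<^sup>2) = cnj (fourier_measure \<mu> \<eta>) * fourier_measure \<mu> \<eta>"
      using complex_norm_square[of "fourier_measure \<mu> \<eta>"] by (simp add: mult.commute)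
    also have "\<dots> = (LINT y|\<mu>. cis (2 * pi * (\<eta> \<bullet> y))) * (LINT z|\<mu>. cis (- (2 * pi * (\<eta> \<bullet> z))))"
    proof -
      have "cnj (fourier_measure \<mu> \<eta>) = (LINT y|\<mu>. cis (2 * pi * (\<eta> \<bullet> y)))"
        unfolding fourier_measure_def
        using Bochner_Integration.integral_cnj[of \<mu> "\<lambda>y. cis (- (2 * pi * (\<eta> \<bullet> y)))"] by (simp add: cis_cnj)
      then show ?thesis by (simp only: fourier_measure_def)
    qed
    also have "\<dots> = (LINT y|\<mu>. LINT z|\<mu>. cis (2 * pi * (\<eta> \<bullet> (y - z))))"
      unfolding cis_split by simp
    also have "\<dots> = (LINT p|(\<mu> \<Otimes>\<^sub>M \<mu>). cis (2 * pi * (\<eta> \<bullet> (fst p - snd p))))"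
      by (subst \<mu>\<mu>.integral_fst'[symmetric])
         (auto intro!: \<mu>\<mu>.P.integrable_const_bound[of _ 1])
    finally show ?thesis .
  qed
  let ?H = "\<lambda>\<eta> p. complex_of_real (gauss \<sigma> \<eta>) * cis (2 * pi * (\<eta> \<bullet> (fst p - snd p)))"
  have int: "integrable (lborel \<Otimes>\<^sub>M (\<mu> \<Otimes>\<^sub>M \<mu>)) (\<lambda>(\<eta>, p). ?H \<eta> p)"
  proof (rule L.Fubini_integrable)
    show "integrable lborel (\<lambda>\<eta>. LINT p|(\<mu> \<Otimes>\<^sub>M \<mu>). norm (case (\<eta>, p) of (\<eta>, p) \<Rightarrow> ?H \<eta> p))"
      using gauss_integrable[OF \<sigma>] by (simp add: norm_mult gauss_nonneg \<mu>\<mu>.P.prob_space)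
    show "AE \<eta> in lborel. integrable (\<mu> \<Otimes>\<^sub>M \<mu>) (\<lambda>p. case (\<eta>, p) of (\<eta>, p) \<Rightarrow> ?H \<eta> p)"
      by (auto intro!: AE_I2 \<mu>\<mu>.P.integrable_const_bound[of _ "gauss \<sigma> _"] simp: norm_mult gauss_nonneg)
  qed measurable
  have "(LINT \<eta>|lborel. complex_of_real (gauss \<sigma> \<eta> * (cmod (fourier_measure \<mu> \<eta>))\<^sup>2))
      = (LINT \<eta>|lborel. LINT p|(\<mu> \<Otimes>\<^sub>M \<mu>). ?H \<eta> p)"
    unfolding of_real_mult sq by simp
  also have "\<dots> = (LINT p|(\<mu> \<Otimes>\<^sub>M \<mu>). LINT \<eta>|lborel. ?H \<eta> p)"
    by (rule L.Fubini_integral[OF int, symmetric])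
  also have "\<dots> = (LINT p|(\<mu> \<Otimes>\<^sub>M \<mu>). of_real (exp (- (\<sigma> * (2 * pi) * norm (fst p - snd p))\<^sup>2 / 2)))"
    by (simp only: gauss_fourier[OF \<sigma>])
  finally have real: "(LINT \<eta>|lborel. gauss \<sigma> \<eta> * (cmod (fourier_measure \<mu> \<eta>))\<^sup>2)
      = (LINT p|(\<mu> \<Otimes>\<^sub>M \<mu>). exp (- (\<sigma> * (2 * pi) * norm (fst p - snd p))\<^sup>2 / 2))"
    by (simp only: integral_complex_of_real of_real_eq_iff)
  have bound: "cmod (fourier_measure \<mu> \<eta>) \<le> 1" for \<eta>
    using Bochner_Integration.integral_norm_bound[of \<mu> "\<lambda>y. cis (- (2 * pi * (\<eta> \<bullet> y)))"]
    unfolding fourier_measure_def by (simp add: \<mu>.prob_space)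
  have "integrable lborel (\<lambda>\<eta>. gauss \<sigma> \<eta> * (cmod (fourier_measure \<mu> \<eta>))\<^sup>2)"
    by (rule Bochner_Integration.integrable_bound[OF gauss_integrable[OF \<sigma>]])
       (auto simp: abs_mult gauss_nonneg power_le_one bound intro!: mult_left_le)
  then have "(\<integral>\<^sup>+\<eta>. ennreal (gauss \<sigma> \<eta> * (cmod (fourier_measure \<mu> \<eta>))\<^sup>2) \<partial>lborel)
      = ennreal (LINT \<eta>|lborel. gauss \<sigma> \<eta> * (cmod (fourier_measure \<mu> \<eta>))\<^sup>2)"
    by (intro nn_integral_eq_integral) (auto simp: gauss_nonneg)
  also have "\<dots> = (\<integral>\<^sup>+p. ennreal (exp (- (\<sigma> * (2 * pi) * norm (fst p - snd p))\<^sup>2 / 2)) \<partial>(\<mu> \<Otimes>\<^sub>M \<mu>))"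
    unfolding real
    by (intro nn_integral_eq_integral[symmetric] \<mu>\<mu>.P.integrable_const_bound[of _ 1]) auto
  finally show ?thesis .
qed

text \<open>A Gaussian lies below every negative power. The estimate is \<open>ln u \<le> u\<close> followed by
  \<open>p u \<le> p\<^sup>2 / 4 + u\<^sup>2\<close>, an instance of the square of \<open>p / 2 - u\<close> being nonnegative.\<close>

lemma exp_square_le_powr:
  fixes u p :: real
  assumes "0 < u" "0 \<le> p"
  shows "exp (- 2 * pi\<^sup>2 * u\<^sup>2) \<le> exp (p\<^sup>2 / 4) * u powr (- p)"
proof -
  have "p * ln u \<le> p * u"
    using assms ln_le_minus_one[of u] by (intro mult_left_mono) auto
  also have "p * u \<le> p\<^sup>2 / 4 + u\<^sup>2"
    using zero_le_power2[of "p / 2 - u"] by (simp add: power2_diff power_divide)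
  finally have 1: "p * ln u \<le> p\<^sup>2 / 4 + u\<^sup>2" .
  have "1 \<le> 2 * pi\<^sup>2" using pi_ge_two power_mono[of 2 pi 2] by simp
  then have "1 * u\<^sup>2 \<le> 2 * pi\<^sup>2 * u\<^sup>2" by (intro mult_right_mono) auto
  with 1 have "- 2 * pi\<^sup>2 * u\<^sup>2 \<le> p\<^sup>2 / 4 + - p * ln u" by simp
  then show ?thesis using assms by (simp add: powr_def exp_add[symmetric])
qed

text \<open>At scale \<open>\<epsilon>\<close> the indicator of \<open>\<bar>y - z\<bar> \<le> \<epsilon>\<close> is at most \<open>exp (1/2)\<close> times the Gaussian
  \<open>exp (- \<bar>y - z\<bar>\<^sup>2 / (2 \<epsilon>\<^sup>2))\<close>. On the frequency side this Gaussian is \<open>\<epsilon>\<^sup>n\<close> times a function of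
  \<open>\<epsilon> \<eta>\<close>, which is bounded by a multiple of \<open>\<bar>\<epsilon> \<eta>\<bar>\<^bsup>2S\<^esup>\<close>; pulling out the powers of \<open>\<epsilon>\<close> gives the
  exponent \<open>n + 2 S\<close>.\<close>

lemma correlation_bound:
  fixes \<mu> :: "(real^'n) measure" and w :: "real^'n \<Rightarrow> real" and S :: real
  assumes prob: "prob_space \<mu>" and sets [measurable_cong]: "sets \<mu> = sets borel"
    and S: "S \<le> 0" and c: "0 < c"
    and w: "AE \<eta> in lborel. c * norm \<eta> powr (2 * S) \<le> w \<eta>"
    and w_meas [measurable]: "w \<in> borel_measurable borel"
    and J: "(\<integral>\<^sup>+\<eta>. ennreal ((cmod (fourier_measure \<mu> \<eta>))\<^sup>2 * w \<eta>) \<partial>lborel) < \<infinity>"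
  obtains C where "0 \<le> C" "\<And>\<epsilon>. 0 < \<epsilon> \<Longrightarrow> (\<integral>\<^sup>+y. emeasure \<mu> (cball y \<epsilon>) \<partial>\<mu>) \<le> ennreal (C * \<epsilon> powr (CARD('n) + 2 * S))"
proof -
  interpret \<mu>: prob_space \<mu> by fact
  define J where "J = enn2real (\<integral>\<^sup>+\<eta>. ennreal ((cmod (fourier_measure \<mu> \<eta>))\<^sup>2 * w \<eta>) \<partial>lborel)"
  have J_eq: "(\<integral>\<^sup>+\<eta>. ennreal ((cmod (fourier_measure \<mu> \<eta>))\<^sup>2 * w \<eta>) \<partial>lborel) = ennreal J"
    using J by (simp add: J_def)
  have "0 \<le> J" by (simp add: J_def)
  have [measurable]: "fourier_measure \<mu> \<in> borel_measurable borel"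
    unfolding fourier_measure_def[abs_def] by measurable
  define K where "K = sqrt (2 * pi) ^ CARD('n) * exp (S\<^sup>2) / c"
  have "0 \<le> K" using c by (simp add: K_def)
  have "(\<integral>\<^sup>+y. emeasure \<mu> (cball y \<epsilon>) \<partial>\<mu>) \<le> ennreal (exp (1/2) * K * J * \<epsilon> powr (CARD('n) + 2 * S))"
    if \<epsilon>: "0 < \<epsilon>" for \<epsilon>
  proof -
    \<comment> \<open>With this width the Gaussian in the distance is \<open>exp (- \<bar>y - z\<bar>\<^sup>2 / (2 \<epsilon>\<^sup>2))\<close>.\<close>
    define \<sigma> where "\<sigma> = 1 / (2 * pi * \<epsilon>)"
    have \<sigma>: "0 < \<sigma>" using \<epsilon> by (simp add: \<sigma>_def)
    let ?D = "{p \<in> space (\<mu> \<Otimes>\<^sub>M \<mu>). dist (fst p) (snd p) \<le> \<epsilon>}"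
    have D [measurable]: "?D \<in> sets (\<mu> \<Otimes>\<^sub>M \<mu>)" by measurable
    have sp: "space \<mu> = UNIV" using sets_eq_imp_space_eq[OF sets] by simp
    have "(\<integral>\<^sup>+y. emeasure \<mu> (cball y \<epsilon>) \<partial>\<mu>) = emeasure (\<mu> \<Otimes>\<^sub>M \<mu>) ?D"
      by (subst \<mu>.emeasure_pair_measure_alt[OF D])
         (auto intro!: nn_integral_cong arg_cong[where f = "emeasure \<mu>"] simp: space_pair_measure sp)
    also have "\<dots> = (\<integral>\<^sup>+p. indicator ?D p \<partial>(\<mu> \<Otimes>\<^sub>M \<mu>))"
      using D by simp
    also have "\<dots> \<le> (\<integral>\<^sup>+p. ennreal (exp (1/2)) * ennreal (exp (- (\<sigma> * (2 * pi) * norm (fst p - snd p))\<^sup>2 / 2)) \<partial>(\<mu> \<Otimes>\<^sub>M \<mu>))"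
    proof (rule nn_integral_mono)
      fix p
      show "indicator ?D p \<le> ennreal (exp (1/2)) * ennreal (exp (- (\<sigma> * (2 * pi) * norm (fst p - snd p))\<^sup>2 / 2))"
      proof (cases "p \<in> ?D")
        case True
        then have "norm (fst p - snd p) / \<epsilon> \<le> 1" using \<epsilon> by (simp add: dist_norm)
        then have "(norm (fst p - snd p) / \<epsilon>)\<^sup>2 \<le> 1" using \<epsilon> by (intro power_le_one) auto
        moreover have "\<sigma> * (2 * pi) * norm (fst p - snd p) = norm (fst p - snd p) / \<epsilon>"
          by (simp add: \<sigma>_def)
        ultimately have "1 \<le> exp (1/2) * exp (- (\<sigma> * (2 * pi) * norm (fst p - snd p))\<^sup>2 / 2)"
          by (simp add: exp_add[symmetric])
        then show ?thesis using True by (simp add: ennreal_mult[symmetric])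
      qed simp
    qed
    also have "\<dots> = ennreal (exp (1/2)) * (\<integral>\<^sup>+\<eta>. ennreal (gauss \<sigma> \<eta> * (cmod (fourier_measure \<mu> \<eta>))\<^sup>2) \<partial>lborel)"
      unfolding fourier_gauss_identity[OF prob sets \<sigma>] by (rule nn_integral_cmult) measurable
    also have "(\<integral>\<^sup>+\<eta>. ennreal (gauss \<sigma> \<eta> * (cmod (fourier_measure \<mu> \<eta>))\<^sup>2) \<partial>lborel)
        \<le> (\<integral>\<^sup>+\<eta>. ennreal (K * \<epsilon> powr (CARD('n) + 2 * S)) * ennreal ((cmod (fourier_measure \<mu> \<eta>))\<^sup>2 * w \<eta>) \<partial>lborel)"
    proof (rule nn_integral_mono_AE)
      have "AE \<eta> in lborel. \<eta> \<noteq> (0 :: real^'n)" by (rule AE_lborel_singleton)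
      with w show "AE \<eta> in lborel. ennreal (gauss \<sigma> \<eta> * (cmod (fourier_measure \<mu> \<eta>))\<^sup>2)
          \<le> ennreal (K * \<epsilon> powr (CARD('n) + 2 * S)) * ennreal ((cmod (fourier_measure \<mu> \<eta>))\<^sup>2 * w \<eta>)"
      proof eventually_elim
        case (elim \<eta>)
        let ?k = "(sqrt (2 * pi) * \<epsilon>) ^ CARD('n)"
        have "gauss \<sigma> \<eta> = ?k * exp (- 2 * pi\<^sup>2 * (\<epsilon> * norm \<eta>)\<^sup>2)"
        proof -
          have "1 / (sqrt (2 * pi) * \<sigma>) = sqrt (2 * pi) * \<epsilon>"
            using \<epsilon> by (simp add: \<sigma>_def field_simps)
          moreover have "- (norm \<eta>)\<^sup>2 / (2 * \<sigma>\<^sup>2) = - 2 * pi\<^sup>2 * (\<epsilon> * norm \<eta>)\<^sup>2"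
            using \<epsilon> by (simp add: \<sigma>_def field_simps power2_eq_square)
          ultimately show ?thesis unfolding gauss_eq[OF \<sigma>] by simp
        qed
        also have "\<dots> \<le> ?k * (exp (S\<^sup>2) * (\<epsilon> * norm \<eta>) powr (2 * S))"
          using exp_square_le_powr[of "\<epsilon> * norm \<eta>" "- 2 * S"] elim \<epsilon> S
          by (intro mult_left_mono) (auto simp: power_mult_distrib)
        also have "\<dots> = K * \<epsilon> powr (CARD('n) + 2 * S) * (c * norm \<eta> powr (2 * S))"
          using c \<epsilon> by (simp add: K_def powr_mult powr_add powr_realpow power_mult_distrib)
        also have "\<dots> \<le> K * \<epsilon> powr (CARD('n) + 2 * S) * w \<eta>"
          using elim \<open>0 \<le> K\<close> by (intro mult_left_mono) auto
        finally have g: "gauss \<sigma> \<eta> \<le> K * \<epsilon> powr (CARD('n) + 2 * S) * w \<eta>" .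
        have "0 \<le> c * norm \<eta> powr (2 * S)" using c by simp
        then have w0: "0 \<le> w \<eta>" using elim by linarith
        have "gauss \<sigma> \<eta> * (cmod (fourier_measure \<mu> \<eta>))\<^sup>2
            \<le> (K * \<epsilon> powr (CARD('n) + 2 * S) * w \<eta>) * (cmod (fourier_measure \<mu> \<eta>))\<^sup>2"
          using g by (intro mult_right_mono) auto
        also have "\<dots> = (K * \<epsilon> powr (CARD('n) + 2 * S)) * ((cmod (fourier_measure \<mu> \<eta>))\<^sup>2 * w \<eta>)"
          by (simp only: mult_ac)
        finally show ?case
          using \<open>0 \<le> K\<close> w0 by (simp only: ennreal_mult[symmetric] ennreal_leI mult_nonneg_nonneg powr_ge_zero zero_le_power2)
      qed
    qed
    also have "\<dots> = ennreal (K * \<epsilon> powr (CARD('n) + 2 * S)) * ennreal J"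
      unfolding J_eq[symmetric] by (rule nn_integral_cmult) measurable
    finally have "(\<integral>\<^sup>+y. emeasure \<mu> (cball y \<epsilon>) \<partial>\<mu>)
        \<le> ennreal (exp (1/2)) * (ennreal (K * \<epsilon> powr (CARD('n) + 2 * S)) * ennreal J)"
      by (simp add: mult_left_mono)
    also have "\<dots> = ennreal (exp (1/2) * K * J * \<epsilon> powr (CARD('n) + 2 * S))"
      using \<open>0 \<le> K\<close> \<open>0 \<le> J\<close> by (simp add: ennreal_mult[symmetric] mult_ac)
    finally show ?thesis .
  qed
  then show thesis
    using \<open>0 \<le> K\<close> \<open>0 \<le> J\<close> by (intro that[of "exp (1/2) * K * J"]) auto
qed

section \<open>Consequences of a correlation bound\<close>

lemma measurable_emeasure_cball:
  fixes \<mu> :: "'a::euclidean_space measure"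
  assumes "finite_measure \<mu>" and sets [measurable_cong]: "sets \<mu> = sets borel"
  shows "(\<lambda>y. emeasure \<mu> (cball y \<epsilon>)) \<in> borel_measurable borel"
proof -
  interpret finite_measure \<mu> by fact
  have "{p \<in> space (borel \<Otimes>\<^sub>M \<mu>). dist (fst p) (snd p) \<le> \<epsilon>} \<in> sets (borel \<Otimes>\<^sub>M \<mu>)" by measurable
  from measurable_emeasure_Pair[OF this] show ?thesis
    by (rule measurable_cong[THEN iffD1, rotated])
       (auto intro!: arg_cong[where f = "emeasure \<mu>"] simp: space_pair_measure sets_eq_imp_space_eq[OF sets])
qed

text \<open>The hypothesis on the function \<open>h\<close> says that dyadic balls around \<open>y\<close> have mass at most
  \<open>h y\<close> times the power \<open>t\<close> of the radius. On a subset of positive mass \<open>h\<close> is bounded, and there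
  every covering set has at most a constant times its diameter to the power \<open>t\<close> as mass. A covering
  set need not be measurable, so it is replaced by a closed ball centred at one of its points. Sets
  of diameter \<open>0\<close> are treated separately: for \<open>t > 0\<close> a point where \<open>h\<close> is finite has no mass, and for \<open>t = 0\<close> a
  nonempty set is counted with weight \<open>1\<close>.\<close>

lemma mass_distribution_principle:
  fixes \<mu> :: "'a::euclidean_space measure" and h :: "'a \<Rightarrow> ennreal"
  assumes fin: "finite_measure \<mu>" and sets: "sets \<mu> = sets borel"
    and t: "0 \<le> t" and h [measurable]: "h \<in> borel_measurable borel"
    and h_fin: "AE y in \<mu>. h y < \<infinity>"
    and ball: "\<And>y k. ennreal (2 powr (t * real k)) * emeasure \<mu> (cball y (1 / 2 ^ k)) \<le> h y"
    and Y: "Y \<in> sets borel" "emeasure \<mu> Y > 0"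
  shows "hausdorff_measure t Y > 0"
proof -
  interpret finite_measure \<mu> by fact
  have ball_diam: "emeasure \<mu> (cball y (diameter U)) \<le> h y * ennreal (2 powr t) * diam_pow t U"
    if "y \<in> U" "bounded U" "diameter U \<le> 1" "h y < \<infinity>" for y U
  proof (cases "diameter U = 0")
    case True
    show ?thesis
    proof (cases "t = 0")
      case True
      have "emeasure \<mu> (cball y (diameter U)) \<le> emeasure \<mu> (cball y (1 / 2 ^ 0))"
        using that(3) by (intro emeasure_mono) (auto simp: sets)
      also have "\<dots> \<le> h y" using ball[of 0 y] True by simp
      finally show ?thesis using that(1) True by (auto simp: diam_pow_def)
    next
      case False
      have small: "emeasure \<mu> {y} \<le> ennreal (enn2real (h y) * (2 powr (- t)) ^ k)" for k
      proof -
        have "ennreal (2 powr (t * real k)) * emeasure \<mu> {y} \<le> ennreal (2 powr (t * real k)) * emeasure \<mu> (cball y (1 / 2 ^ k))"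
          by (intro mult_left_mono emeasure_mono) (auto simp: sets)
        also have "\<dots> \<le> h y" by (rule ball)
        also have "\<dots> = ennreal (enn2real (h y))" using that(4) by simp
        finally have "2 powr (t * real k) * measure \<mu> {y} \<le> enn2real (h y)"
          by (simp add: emeasure_eq_measure ennreal_mult[symmetric])
        then have "measure \<mu> {y} \<le> enn2real (h y) * 2 powr (- (t * real k))"
          by (simp add: powr_minus field_simps)
        also have "2 powr (- (t * real k)) = (2 powr (- t)) ^ k"
          by (simp add: powr_realpow[symmetric] powr_powr)
        finally show ?thesis by (simp add: emeasure_eq_measure ennreal_leI)
      qed
      have "2 powr (- t) < (1::real)" using t False by (simp add: powr_less_one)
      then have "(\<lambda>k. enn2real (h y) * (2 powr (- t)) ^ k) \<longlonglongrightarrow> enn2real (h y) * 0"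
        by (intro tendsto_mult tendsto_const LIMSEQ_power_zero) simp
      then have "(\<lambda>k. ennreal (enn2real (h y) * (2 powr (- t)) ^ k)) \<longlonglongrightarrow> ennreal 0"
        by (intro tendsto_ennrealI) simp
      then have "emeasure \<mu> {y} \<le> ennreal 0"
        by (rule LIMSEQ_le_const) (use small in auto)
      then show ?thesis using \<open>diameter U = 0\<close> by simp
    qed
  next
    case False
    then have D: "0 < diameter U" using diameter_ge_0[OF that(2)] by simp
    \<comment> \<open>The dyadic scale just above the diameter: \<open>2 powr (- k - 1) < diameter U \<le> 2 powr (- k)\<close>.\<close>
    define k where "k = nat \<lfloor>- log 2 (diameter U)\<rfloor>"
    have "0 \<le> - log 2 (diameter U)" using D that(3) by simp
    then have k: "real k \<le> - log 2 (diameter U)" "- log 2 (diameter U) < real k + 1"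
      unfolding k_def by linarith+
    have "diameter U = 2 powr (log 2 (diameter U))" using D by simp
    also have "\<dots> \<le> 2 powr (- real k)" using k by simp
    also have "\<dots> = 1 / 2 ^ k" by (simp add: powr_minus powr_realpow divide_inverse)
    finally have up: "diameter U \<le> 1 / 2 ^ k" .
    have "1 \<le> 2 powr (t * real k) * (2 powr t * diameter U powr t)"
    proof -
      have "0 \<le> t * (real k + 1 + log 2 (diameter U))" using k t by (intro mult_nonneg_nonneg) auto
      then have "(2 :: real) powr 0 \<le> 2 powr (t * (real k + 1 + log 2 (diameter U)))"
        by (intro powr_mono) auto
      also have "\<dots> = 2 powr (t * real k) * (2 powr t * (2 powr (log 2 (diameter U))) powr t)"
        by (simp add: powr_powr powr_add[symmetric] algebra_simps del: powr_log_cancel)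
      finally show ?thesis using D by simp
    qed
    then have one: "1 \<le> ennreal (2 powr (t * real k)) * (ennreal (2 powr t) * ennreal (diameter U powr t))"
      by (simp add: ennreal_mult[symmetric])
    have diam: "ennreal (diameter U powr t) = diam_pow t U"
      using that(1) D by (auto simp: diam_pow_def)
    have "emeasure \<mu> (cball y (diameter U)) \<le> emeasure \<mu> (cball y (1 / 2 ^ k))"
      using up by (intro emeasure_mono) (auto simp: sets)
    also have "\<dots> \<le> (ennreal (2 powr (t * real k)) * (ennreal (2 powr t) * diam_pow t U)) * emeasure \<mu> (cball y (1 / 2 ^ k))"
      using mult_right_mono[OF one, of "emeasure \<mu> (cball y (1 / 2 ^ k))"] diam by simp
    also have "\<dots> = (ennreal (2 powr (t * real k)) * emeasure \<mu> (cball y (1 / 2 ^ k))) * (ennreal (2 powr t) * diam_pow t U)"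
      by (simp only: mult_ac)
    also have "\<dots> \<le> h y * (ennreal (2 powr t) * diam_pow t U)"
      by (intro mult_right_mono ball) simp
    finally show ?thesis by (simp only: mult.assoc)
  qed
  define Z where "Z n = {y \<in> Y. h y \<le> of_nat n}" for n :: nat
  have Z [measurable]: "Z n \<in> sets \<mu>" for n
    unfolding Z_def sets using Y(1) by measurable
  have "\<exists>n. emeasure \<mu> (Z n) > 0"
  proof (rule ccontr)
    assume "\<nexists>n. emeasure \<mu> (Z n) > 0"
    then have "(\<Union>n. Z n) \<in> null_sets \<mu>" by (intro null_sets_UN) (auto simp: null_sets_def)
    then have "AE y in \<mu>. y \<notin> (\<Union>n. Z n)" by (rule AE_not_in)
    with h_fin have "AE y in \<mu>. y \<notin> Y"
    proof eventually_elim
      case (elim y)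
      then obtain n :: nat where "h y < of_nat n" using ennreal_Ex_less_of_nat by auto
      then have "h y \<le> of_nat n" by (rule less_imp_le)
      then show ?case using elim(2) by (auto simp: Z_def)
    qed
    then have "Y \<in> null_sets \<mu>" using Y(1) by (subst AE_iff_null_sets) (auto simp: sets)
    then show False using Y(2) by (simp add: null_sets_def)
  qed
  then obtain n where n: "emeasure \<mu> (Z n) > 0" by blast
  define c where "c = ennreal (real n * 2 powr t)"
  have c: "of_nat n * ennreal (2 powr t) = c"
    unfolding c_def ennreal_of_nat_eq_real_of_nat by (rule ennreal_mult[symmetric]) auto
  have cover: "emeasure \<mu> (Z n) \<le> c * (\<Sum>k. diam_pow t (U k))"
    if U: "Y \<subseteq> (\<Union>k. U k)" "\<forall>k. bounded (U k) \<and> diameter (U k) \<le> 1" for U :: "nat \<Rightarrow> 'a set"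
  proof -
    \<comment> \<open>The balls that replace those members of the cover that meet the set where \<open>h\<close> is at most \<open>n\<close>.\<close>
    define V where "V k = (if U k \<inter> Z n = {} then {} else cball (SOME y. y \<in> U k \<inter> Z n) (diameter (U k)))" for k
    have y: "(SOME y. y \<in> U k \<inter> Z n) \<in> U k \<inter> Z n" if "U k \<inter> Z n \<noteq> {}" for k
    proof -
      have "\<exists>y. y \<in> U k \<inter> Z n" using that by blast
      then show ?thesis by (rule someI_ex)
    qed
    have "Z n \<subseteq> (\<Union>k. V k)"
    proof
      fix z assume z: "z \<in> Z n"
      then obtain k where k: "z \<in> U k" using U(1) by (auto simp: Z_def)
      have ne: "U k \<inter> Z n \<noteq> {}" using z k by blast
      have "dist (SOME y. y \<in> U k \<inter> Z n) z \<le> diameter (U k)"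
        using y[OF ne] k U(2) by (intro diameter_bounded_bound) auto
      then show "z \<in> (\<Union>k. V k)" using ne by (auto simp: V_def)
    qed
    then have "emeasure \<mu> (Z n) \<le> emeasure \<mu> (\<Union>k. V k)"
      by (intro emeasure_mono) (auto simp: sets V_def)
    also have "\<dots> \<le> (\<Sum>k. emeasure \<mu> (V k))"
      by (rule emeasure_subadditive_countably) (auto simp: sets V_def)
    also have "\<dots> \<le> (\<Sum>k. c * diam_pow t (U k))"
    proof (rule suminf_le)
      fix k
      show "emeasure \<mu> (V k) \<le> c * diam_pow t (U k)"
      proof (cases "U k \<inter> Z n = {}")
        case False
        let ?y = "SOME y. y \<in> U k \<inter> Z n"
        have hy: "h ?y \<le> of_nat n" "?y \<in> U k" using y[OF False] by (auto simp: Z_def)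
        then have "h ?y < \<infinity>" using of_nat_less_top le_less_trans by (metis infinity_ennreal_def)
        then have "emeasure \<mu> (V k) \<le> h ?y * ennreal (2 powr t) * diam_pow t (U k)"
          using ball_diam[of ?y "U k"] hy U(2) False by (simp add: V_def)
        also have "\<dots> \<le> of_nat n * ennreal (2 powr t) * diam_pow t (U k)"
          using hy by (intro mult_right_mono) auto
        finally show ?thesis by (simp only: c)
      qed (simp add: V_def)
    qed auto
    also have "\<dots> = c * (\<Sum>k. diam_pow t (U k))" by simp
    finally show ?thesis .
  qed
  have fin_c: "c < \<top>" by (simp add: c_def)
  have "emeasure \<mu> (Z n) / c \<le> hausdorff_content t 1 Y"
    unfolding hausdorff_content_def
  proof (rule Inf_greatest)
    fix x assume "x \<in> {(\<Sum>n. diam_pow t (U n)) | U :: nat \<Rightarrow> 'a set.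
            Y \<subseteq> (\<Union>n. U n) \<and> (\<forall>n. bounded (U n) \<and> diameter (U n) \<le> 1)}"
    then obtain U :: "nat \<Rightarrow> 'a set" where U: "x = (\<Sum>k. diam_pow t (U k))" "Y \<subseteq> (\<Union>k. U k)"
      "\<forall>k. bounded (U k) \<and> diameter (U k) \<le> 1" by blast
    have le: "emeasure \<mu> (Z n) \<le> c * x" using cover[OF U(2,3)] U(1) by simp
    with n have "c \<noteq> 0" by auto
    then show "emeasure \<mu> (Z n) / c \<le> x"
      using le fin_c by (intro divide_le_posI_ennreal) (auto simp: zero_less_iff_neq_zero mult.commute)
  qed
  moreover have "0 < emeasure \<mu> (Z n) / c"
    using n fin_c by (simp add: ennreal_zero_less_divide)
  moreover have "hausdorff_content t 1 Y \<le> hausdorff_measure t Y"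
    unfolding hausdorff_measure_def by (rule SUP_upper) simp
  ultimately show ?thesis by (meson less_le_trans)
qed

text \<open>For \<open>t < \<alpha>\<close> the function \<open>h\<close> of the mass distribution principle can be taken to be
  \<open>\<Sum>k. 2\<^bsup>tk\<^esup> \<mu>(B(y, 2\<^bsup>-k\<^esup>))\<close>: its integral is dominated by a geometric series of ratio
  \<open>2\<^bsup>t-\<alpha>\<^esup>\<close>.\<close>

lemma hausdorff_dim_measure_ge:
  fixes \<mu> :: "'a::euclidean_space measure"
  assumes prob: "prob_space \<mu>" and sets [measurable_cong]: "sets \<mu> = sets borel"
    and C: "0 \<le> C" and corr: "\<And>\<epsilon>. 0 < \<epsilon> \<Longrightarrow> (\<integral>\<^sup>+y. emeasure \<mu> (cball y \<epsilon>) \<partial>\<mu>) \<le> ennreal (C * \<epsilon> powr \<alpha>)"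
  shows "ereal \<alpha> \<le> hausdorff_dim_measure \<mu>"
  unfolding hausdorff_dim_measure_def
proof (rule Inf_greatest, clarify)
  fix Y :: "'a set" assume Y: "Y \<in> sets borel" "emeasure \<mu> (space \<mu> - Y) = 0"
  interpret prob_space \<mu> by fact
  have Y1: "emeasure \<mu> Y > 0"
  proof -
    have "AE y in \<mu>. y \<in> Y"
      using Y sets by (intro AE_I[of _ _ "space \<mu> - Y"]) auto
    then have "emeasure \<mu> Y = 1" using emeasure_eq_1_AE Y(1) sets by blast
    then show ?thesis by simp
  qed
  show "ereal \<alpha> \<le> hausdorff_dim Y"
    unfolding hausdorff_dim_def
  proof (rule Inf_greatest, clarify)
    fix t :: real assume t: "0 \<le> t" "hausdorff_measure t Y = 0"
    show "ereal \<alpha> \<le> ereal t"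
    proof (rule ccontr)
      assume "\<not> ereal \<alpha> \<le> ereal t"
      then have lt: "t < \<alpha>" by simp
      have fin: "finite_measure \<mu>" by (rule finite_measure)
      note [measurable] = measurable_emeasure_cball[OF fin sets]
      define h where "h y = (\<Sum>k. ennreal (2 powr (t * real k)) * emeasure \<mu> (cball y (1 / 2 ^ k)))" for y
      have h [measurable]: "h \<in> borel_measurable borel" unfolding h_def by measurable
      have "(\<integral>\<^sup>+y. h y \<partial>\<mu>) = (\<Sum>k. ennreal (2 powr (t * real k)) * (\<integral>\<^sup>+y. emeasure \<mu> (cball y (1 / 2 ^ k)) \<partial>\<mu>))"
        unfolding h_def by (subst nn_integral_suminf) (auto simp: nn_integral_cmult)
      also have "\<dots> \<le> (\<Sum>k. ennreal (C * (2 powr (t - \<alpha>)) ^ k))"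
      proof (rule suminf_le)
        fix k :: nat
        have "ennreal (2 powr (t * real k)) * (\<integral>\<^sup>+y. emeasure \<mu> (cball y (1 / 2 ^ k)) \<partial>\<mu>)
            \<le> ennreal (2 powr (t * real k)) * ennreal (C * (1 / 2 ^ k) powr \<alpha>)"
          by (intro mult_left_mono corr) auto
        also have "\<dots> = ennreal (C * (2 powr (t * real k) * (1 / 2 ^ k) powr \<alpha>))"
          using C by (simp add: ennreal_mult[symmetric] mult_ac)
        also have "2 powr (t * real k) * (1 / 2 ^ k) powr \<alpha> = (2 powr (t - \<alpha>)) ^ k"
        proof -
          have "(1 / 2 ^ k :: real) = 2 powr (- real k)"
            by (simp add: powr_minus powr_realpow divide_inverse)
          then show ?thesis
            by (simp add: powr_powr powr_add[symmetric] powr_realpow[symmetric] algebra_simps)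
        qed
        finally show "ennreal (2 powr (t * real k)) * (\<integral>\<^sup>+y. emeasure \<mu> (cball y (1 / 2 ^ k)) \<partial>\<mu>)
            \<le> ennreal (C * (2 powr (t - \<alpha>)) ^ k)" .
      qed auto
      also have "\<dots> < \<infinity>"
      proof -
        have "2 powr (t - \<alpha>) < (1 :: real)" using lt by (simp add: powr_less_one)
        then have "summable (\<lambda>k. C * (2 powr (t - \<alpha>)) ^ k)"
          by (intro summable_mult summable_geometric) simp
        then show ?thesis
          using C by (subst suminf_ennreal2) auto
      qed
      finally have "AE y in \<mu>. h y \<noteq> \<infinity>"
        by (intro nn_integral_PInf_AE) auto
      then have "AE y in \<mu>. h y < \<infinity>" by (simp add: less_top)
      moreover have "ennreal (2 powr (t * real k)) * emeasure \<mu> (cball y (1 / 2 ^ k)) \<le> h y" for y k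
        unfolding h_def using sum_le_suminf[of "\<lambda>k. ennreal (2 powr (t * real k)) * emeasure \<mu> (cball y (1 / 2 ^ k))" "{k}"] by simp
      ultimately have "hausdorff_measure t Y > 0"
        using mass_distribution_principle[OF fin sets t(1) h _ _ Y(1) Y1] by blast
      then show False using t(2) by simp
    qed
  qed
qed

text \<open>The function \<open>z \<mapsto> \<mu>(B(z, \<epsilon>))\<close>, divided by the volume of the ball, is a mollification of
  \<open>\<mu>\<close>. By the correlation bound its square integral is bounded uniformly in \<open>\<epsilon>\<close>, and its integral
  over \<open>U\<close> is at least the mass of the points whose \<open>\<epsilon>\<close>-ball lies in \<open>U\<close>. The Cauchy-Schwarz
  inequality compares the two, and these points exhaust \<open>U\<close> as \<open>\<epsilon>\<close> tends to \<open>0\<close>.\<close>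

lemma open_measure_bound:
  fixes \<mu> :: "'a::euclidean_space measure"
  assumes prob: "prob_space \<mu>" and sets [measurable_cong]: "sets \<mu> = sets borel"
    and C: "0 \<le> C" and corr: "\<And>\<epsilon>. 0 < \<epsilon> \<Longrightarrow> (\<integral>\<^sup>+y. emeasure \<mu> (cball y \<epsilon>) \<partial>\<mu>) \<le> ennreal (C * \<epsilon> ^ DIM('a))"
    and U: "open U"
  shows "(emeasure \<mu> U)\<^sup>2 \<le> ennreal (C * 2 ^ DIM('a) / unit_ball_vol DIM('a)) * emeasure lborel U"
proof -
  interpret prob_space \<mu> by fact
  interpret P: pair_sigma_finite \<mu> "lborel :: 'a measure" ..
  have fin: "finite_measure \<mu>" by (rule finite_measure)
  note [measurable] = measurable_emeasure_cball[OF fin sets]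
  have [measurable]: "U \<in> sets borel" using U by simp
  let ?V = "unit_ball_vol DIM('a)"
  have V: "0 < ?V" by simp
  have space: "space \<mu> = UNIV" using sets_eq_imp_space_eq[OF sets] by simp
  have vol: "emeasure lborel (cball y \<epsilon>) = ennreal (?V * \<epsilon> ^ DIM('a))" if "0 < \<epsilon>" for y :: 'a and \<epsilon>
    using that by (simp add: emeasure_cball)
  define W where "W n = {y. cball y (1 / real (Suc n)) \<subseteq> U}" for n
  have W_eq: "W n = {y. \<forall>z. z \<notin> U \<longrightarrow> \<not> dist y z \<le> 1 / real (Suc n)}" for n
    unfolding W_def subset_iff mem_cball by blast
  have W_bound: "(emeasure \<mu> B)\<^sup>2 \<le> ennreal (C * 2 ^ DIM('a) / ?V) * emeasure lborel U"
    if B: "B \<in> sets borel" "B \<subseteq> {y. cball y \<epsilon> \<subseteq> U}" and \<epsilon>: "0 < \<epsilon>" for B \<epsilon>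
  proof -
    note [measurable] = B(1)
    let ?v = "?V * \<epsilon> ^ DIM('a)"
    have v: "0 < ?v" using \<epsilon> V by simp
    let ?f = "\<lambda>z. emeasure \<mu> (cball z \<epsilon>)"
    have f_int: "?f z = (\<integral>\<^sup>+y. indicator {p. dist (fst p) (snd p) \<le> \<epsilon>} (y, z) \<partial>\<mu>)" for z
    proof -
      have "(\<integral>\<^sup>+y. indicator {p. dist (fst p) (snd p) \<le> \<epsilon>} (y, z) \<partial>\<mu>) = (\<integral>\<^sup>+y. indicator (cball z \<epsilon>) y \<partial>\<mu>)"
        by (intro nn_integral_cong) (auto split: split_indicator simp: dist_commute)
      then show ?thesis by (simp add: sets)
    qed
    have [measurable]: "(\<lambda>(y, z). indicator {p. dist (fst p) (snd p) \<le> \<epsilon>} (y, z) :: ennreal)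
        \<in> borel_measurable (borel \<Otimes>\<^sub>M (borel :: 'a measure))"
      by measurable
    have lower: "ennreal ?v * emeasure \<mu> B \<le> (\<integral>\<^sup>+z. ?f z * indicator U z \<partial>lborel)"
    proof -
      have "ennreal ?v * emeasure \<mu> B = (\<integral>\<^sup>+y. ennreal ?v * indicator B y \<partial>\<mu>)"
        using B(1) by (simp add: nn_integral_cmult sets)
      also have "\<dots> \<le> (\<integral>\<^sup>+y. (\<integral>\<^sup>+z. indicator {p. dist (fst p) (snd p) \<le> \<epsilon>} (y, z) * indicator U z \<partial>lborel) \<partial>\<mu>)"
      proof (rule nn_integral_mono)
        fix y
        show "ennreal ?v * indicator B y \<le> (\<integral>\<^sup>+z. indicator {p. dist (fst p) (snd p) \<le> \<epsilon>} (y, z) * indicator U z \<partial>lborel)"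
        proof (cases "y \<in> B")
          case True
          then have "cball y \<epsilon> \<subseteq> U" using B(2) by blast
          then have "(\<integral>\<^sup>+z. indicator {p. dist (fst p) (snd p) \<le> \<epsilon>} (y, z) * indicator U z \<partial>lborel)
              = (\<integral>\<^sup>+z. indicator (cball y \<epsilon>) z \<partial>lborel)"
            by (intro nn_integral_cong) (auto split: split_indicator)
          then show ?thesis using True vol[OF \<epsilon>] by simp
        qed simp
      qed
      also have "\<dots> = (\<integral>\<^sup>+z. (\<integral>\<^sup>+y. indicator {p. dist (fst p) (snd p) \<le> \<epsilon>} (y, z) * indicator U z \<partial>\<mu>) \<partial>lborel)"
        by (rule P.Fubini'[symmetric]) measurable
      also have "\<dots> = (\<integral>\<^sup>+z. ?f z * indicator U z \<partial>lborel)"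
        unfolding f_int by (intro nn_integral_cong nn_integral_multc) measurable
      finally show ?thesis .
    qed
    \<comment> \<open>If \<open>y\<close> is within \<open>\<epsilon>\<close> of \<open>z\<close>, then the ball of radius \<open>\<epsilon>\<close> at \<open>z\<close> lies in the one of radius \<open>2 \<epsilon>\<close> at \<open>y\<close>.\<close>
    have upper: "(\<integral>\<^sup>+z. (?f z)\<^sup>2 \<partial>lborel) \<le> ennreal (?v * (C * (2 * \<epsilon>) ^ DIM('a)))"
    proof -
      have "(\<integral>\<^sup>+z. (?f z)\<^sup>2 \<partial>lborel) = (\<integral>\<^sup>+z. (\<integral>\<^sup>+y. indicator {p. dist (fst p) (snd p) \<le> \<epsilon>} (y, z) * ?f z \<partial>\<mu>) \<partial>lborel)"
        unfolding power2_eq_square by (subst (1) f_int) (intro nn_integral_cong nn_integral_multc[symmetric], measurable)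
      also have "\<dots> \<le> (\<integral>\<^sup>+z. (\<integral>\<^sup>+y. indicator {p. dist (fst p) (snd p) \<le> \<epsilon>} (y, z) * emeasure \<mu> (cball y (2 * \<epsilon>)) \<partial>\<mu>) \<partial>lborel)"
      proof (intro nn_integral_mono)
        fix z y :: 'a
        have "?f z \<le> emeasure \<mu> (cball y (2 * \<epsilon>))" if "dist y z \<le> \<epsilon>"
          using that by (intro emeasure_mono) (auto simp: sets cball_subset_cball_iff dist_commute)
        then show "indicator {p. dist (fst p) (snd p) \<le> \<epsilon>} (y, z) * ?f z
            \<le> indicator {p. dist (fst p) (snd p) \<le> \<epsilon>} (y, z) * emeasure \<mu> (cball y (2 * \<epsilon>))"
          by (auto split: split_indicator)
      qed
      also have "\<dots> = (\<integral>\<^sup>+y. (\<integral>\<^sup>+z. indicator {p. dist (fst p) (snd p) \<le> \<epsilon>} (y, z) * emeasure \<mu> (cball y (2 * \<epsilon>)) \<partial>lborel) \<partial>\<mu>)"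
        by (rule P.Fubini') measurable
      also have "\<dots> = (\<integral>\<^sup>+y. ennreal ?v * emeasure \<mu> (cball y (2 * \<epsilon>)) \<partial>\<mu>)"
      proof (rule nn_integral_cong)
        fix y :: 'a
        have "(\<integral>\<^sup>+z. indicator {p. dist (fst p) (snd p) \<le> \<epsilon>} (y, z) * emeasure \<mu> (cball y (2 * \<epsilon>)) \<partial>lborel)
            = (\<integral>\<^sup>+z. indicator (cball y \<epsilon>) z * emeasure \<mu> (cball y (2 * \<epsilon>)) \<partial>lborel)"
          by (intro nn_integral_cong) (auto split: split_indicator)
        also have "\<dots> = ennreal ?v * emeasure \<mu> (cball y (2 * \<epsilon>))"
          by (subst nn_integral_multc) (simp_all add: vol[OF \<epsilon>] borel_measurable_indicator)
        finally show "(\<integral>\<^sup>+z. indicator {p. dist (fst p) (snd p) \<le> \<epsilon>} (y, z) * emeasure \<mu> (cball y (2 * \<epsilon>)) \<partial>lborel)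
            = ennreal ?v * emeasure \<mu> (cball y (2 * \<epsilon>))" .
      qed
      also have "\<dots> = ennreal ?v * (\<integral>\<^sup>+y. emeasure \<mu> (cball y (2 * \<epsilon>)) \<partial>\<mu>)"
        by (rule nn_integral_cmult) measurable
      also have "\<dots> \<le> ennreal ?v * ennreal (C * (2 * \<epsilon>) ^ DIM('a))"
        using \<epsilon> by (intro mult_left_mono corr) auto
      also have "\<dots> = ennreal (?v * (C * (2 * \<epsilon>) ^ DIM('a)))"
        using v C \<epsilon> by (intro ennreal_mult[symmetric]) auto
      finally show ?thesis .
    qed
    have "(ennreal ?v * emeasure \<mu> B)\<^sup>2 \<le> (\<integral>\<^sup>+z. ?f z * indicator U z \<partial>lborel)\<^sup>2"
      by (rule power_mono[OF lower]) simp
    also have "\<dots> \<le> (\<integral>\<^sup>+z. (?f z)\<^sup>2 \<partial>lborel) * (\<integral>\<^sup>+z. (indicator U z)\<^sup>2 \<partial>lborel)"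
      by (rule Cauchy_Schwarz_nn_integral) measurable
    also have "(\<integral>\<^sup>+z. (indicator U z)\<^sup>2 \<partial>lborel) = (\<integral>\<^sup>+z. indicator U z \<partial>lborel)"
      by (intro nn_integral_cong) (auto split: split_indicator)
    also have "\<dots> = emeasure lborel U" by simp
    also have "(\<integral>\<^sup>+z. (?f z)\<^sup>2 \<partial>lborel) * emeasure lborel U
        \<le> ennreal (?v * (C * (2 * \<epsilon>) ^ DIM('a))) * emeasure lborel U"
      by (rule mult_right_mono[OF upper]) simp
    also have "?v * (C * (2 * \<epsilon>) ^ DIM('a)) = ?v\<^sup>2 * (C * 2 ^ DIM('a) / ?V)"
      using V by (simp add: field_simps power2_eq_square power_mult_distrib)
    also have "ennreal (?v\<^sup>2 * (C * 2 ^ DIM('a) / ?V)) = (ennreal ?v)\<^sup>2 * ennreal (C * 2 ^ DIM('a) / ?V)"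
      using v C V by (subst ennreal_mult) (auto simp: ennreal_power)
    finally have "(ennreal ?v)\<^sup>2 * (emeasure \<mu> B)\<^sup>2
        \<le> (ennreal ?v)\<^sup>2 * (ennreal (C * 2 ^ DIM('a) / ?V) * emeasure lborel U)"
      by (simp only: power_mult_distrib mult.assoc)
    moreover have "(ennreal ?v)\<^sup>2 = ennreal (?v\<^sup>2)" "0 < ?v\<^sup>2"
      using v by (simp only: ennreal_power less_imp_le, simp only: zero_less_power)
    then have "(ennreal ?v)\<^sup>2 \<noteq> 0" "(ennreal ?v)\<^sup>2 \<noteq> \<top>"
      by (simp_all only: ennreal_eq_0_iff not_le ennreal_neq_top not_False_eq_True)
    ultimately show ?thesis
      using ennreal_mult_le_mult_iff[of "(ennreal ?v)\<^sup>2"] by blast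
  qed
  have W_meas: "W n \<in> sets borel" for n
  proof -
    have "W n = - (\<Union>z\<in>- U. cball z (1 / real (Suc n)))"
      unfolding W_eq by (auto simp: dist_commute)
    moreover have "closed (\<Union>z\<in>- U. cball z (1 / real (Suc n)))"
    proof -
      let ?r = "1 / real (Suc n)"
      have "cball z ?r = (\<Union>e\<in>cball 0 ?r. {z + e})" for z :: 'a
        unfolding UNION_singleton_eq_range using cball_translation[of z 0 ?r] by simp
      then have "(\<Union>z\<in>- U. cball z ?r) = (\<Union>z\<in>- U. \<Union>e\<in>cball 0 ?r. {z + e})"
        by (intro SUP_cong refl)
      moreover have "closed (\<Union>z\<in>- U. \<Union>e\<in>cball 0 ?r. {z + e})"
        using U by (intro closed_compact_sums compact_cball) (simp add: closed_Compl)
      ultimately show ?thesis by (rule ssubst)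
    qed
    ultimately have "open (W n)" by (simp only: open_Compl)
    then show ?thesis by simp
  qed
  have "incseq W"
  proof (rule incseq_SucI)
    fix n
    have "cball y (1 / real (Suc (Suc n))) \<subseteq> cball y (1 / real (Suc n))" for y :: 'a
      by (intro subset_cball) (simp add: frac_le)
    then show "W n \<le> W (Suc n)" unfolding W_def by blast
  qed
  then have "(\<lambda>n. emeasure \<mu> (W n)) \<longlonglongrightarrow> emeasure \<mu> (\<Union>n. W n)"
    using W_meas by (intro Lim_emeasure_incseq) (auto simp: sets)
  also have "(\<Union>n. W n) = U"
  proof
    show "(\<Union>n. W n) \<subseteq> U" by (force simp: W_def)
    show "U \<subseteq> (\<Union>n. W n)"
    proof
      fix y assume "y \<in> U"
      then obtain e where e: "0 < e" "cball y e \<subseteq> U" using U open_contains_cball by blast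
      obtain n where "1 / real (Suc n) < e" using reals_Archimedean[OF e(1)] by (auto simp: inverse_eq_divide)
      then have "cball y (1 / real (Suc n)) \<subseteq> cball y e" by (intro subset_cball) simp
      with e(2) show "y \<in> (\<Union>n. W n)" by (auto simp: W_def)
    qed
  qed
  finally have "(\<lambda>n. (emeasure \<mu> (W n))\<^sup>2) \<longlonglongrightarrow> (emeasure \<mu> U)\<^sup>2"
    unfolding power2_eq_square by (intro tendsto_mult_ennreal) (auto simp: emeasure_eq_measure)
  moreover have "(emeasure \<mu> (W n))\<^sup>2 \<le> ennreal (C * 2 ^ DIM('a) / ?V) * emeasure lborel U" for n
    by (rule W_bound[OF W_meas, of n "1 / real (Suc n)"]) (simp_all add: W_def)
  ultimately show ?thesis
    using LIMSEQ_le_const2 by blast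
qed

lemma absolutely_continuous_of_correlation:
  fixes \<mu> :: "'a::euclidean_space measure"
  assumes prob: "prob_space \<mu>" and sets: "sets \<mu> = sets borel"
    and C: "0 \<le> C" and corr: "\<And>\<epsilon>. 0 < \<epsilon> \<Longrightarrow> (\<integral>\<^sup>+y. emeasure \<mu> (cball y \<epsilon>) \<partial>\<mu>) \<le> ennreal (C * \<epsilon> ^ DIM('a))"
    and N: "N \<in> null_sets lborel"
  shows "emeasure \<mu> N = 0"
proof -
  let ?K = "C * 2 ^ DIM('a) / unit_ball_vol DIM('a)"
  have K: "0 \<le> ?K" using C by simp
  have "(emeasure \<mu> N)\<^sup>2 \<le> 0 + ennreal e" if e: "0 < e" for e
  proof -
    let ?d = "e / (?K + 1)"
    have d: "0 < ?d" using e K by simp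
    have Nb: "N \<in> sets borel" "emeasure lborel N = 0" using N by (auto simp: null_sets_def)
    obtain U where U: "open U" "N \<subseteq> U" "emeasure lborel (U - N) < ennreal ?d"
      using outer_regular_lborel[OF Nb(1) d] by blast
    have "emeasure lborel U = emeasure lborel (U - N)"
      using N U(1) by (intro emeasure_Diff_null_set[symmetric]) auto
    then have UU: "emeasure lborel U \<le> ennreal ?d" using U(3) by simp
    have "(emeasure \<mu> N)\<^sup>2 \<le> (emeasure \<mu> U)\<^sup>2"
      using U by (intro power_mono emeasure_mono) (auto simp: sets)
    also have "\<dots> \<le> ennreal ?K * emeasure lborel U"
      by (rule open_measure_bound[OF prob sets C corr U(1)])
    also have "\<dots> \<le> ennreal ?K * ennreal ?d" by (intro mult_left_mono UU) simp
    also have "\<dots> = ennreal (?K * ?d)" using K d by (intro ennreal_mult[symmetric]) auto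
    also have "\<dots> \<le> ennreal e"
    proof (rule ennreal_leI)
      have "?K * ?d \<le> (?K + 1) * ?d" using d by (intro mult_right_mono) auto
      also have "\<dots> = e" using K by (subst nonzero_mult_div_cancel_left[symmetric, of "?K + 1" e]) auto
      finally show "?K * ?d \<le> e" .
    qed
    finally show ?thesis by (simp only: add_0)
  qed
  then have "(emeasure \<mu> N)\<^sup>2 \<le> 0" by (rule ennreal_le_epsilon)
  then show ?thesis by (simp add: power2_eq_square)
qed

section \<open>From the Sobolev weight to the fibre measures\<close>

text \<open>All exponents are nonpositive and the projections are bounded, so replacing every component by
  a multiple of the full norm only decreases the weight. The comparison weight is
  homogeneous of degree twice the sum of the exponents.\<close>

lemma spectral_weight_ge:
  fixes A :: "real^'n^'n" and s :: "nat \<Rightarrow> real"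
  assumes s: "\<And>i. i \<in> {1..num_moduli A} \<Longrightarrow> s i \<le> 0"
    and d: "\<And>i. i \<in> {1..num_moduli A} \<Longrightarrow> 0 < dim (spectral_space A i)"
  shows "\<exists>c>0. AE \<eta> in lborel. c * norm \<eta> powr (2 * (\<Sum>i\<in>{1..num_moduli A}. s i))
      \<le> (\<Prod>i\<in>{1..num_moduli A}. norm (spectral_proj A i \<eta>) powr (2 * s i))"
proof -
  let ?I = "{1..num_moduli A}"
  have "\<forall>i\<in>?I. \<exists>K>0. \<forall>\<eta>. norm (spectral_proj A i \<eta>) \<le> norm \<eta> * K"
    using linear_spectral_proj linear_conv_bounded_linear bounded_linear.pos_bounded by blast
  from bchoice[OF this] obtain K where K: "\<And>i. i \<in> ?I \<Longrightarrow> 0 < K i"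
      "\<And>i \<eta>. i \<in> ?I \<Longrightarrow> norm (spectral_proj A i \<eta>) \<le> norm \<eta> * K i"
    by blast
  define c where "c = (\<Prod>i\<in>?I. K i powr (2 * s i))"
  have "0 < c" unfolding c_def by (intro prod_pos) (simp add: K(1)[THEN less_imp_neq, symmetric] del: atLeastAtMost_iff)
  moreover have "AE \<eta> in lborel. c * norm \<eta> powr (2 * (\<Sum>i\<in>?I. s i))
      \<le> (\<Prod>i\<in>?I. norm (spectral_proj A i \<eta>) powr (2 * s i))"
  proof -
    have "AE \<eta> in lborel. \<forall>i\<in>?I. spectral_proj A i \<eta> \<noteq> 0"
      by (intro AE_finite_allI finite_atLeastAtMost spectral_proj_nonzero_AE d)
    moreover have "AE \<eta> in lborel. \<eta> \<noteq> (0 :: real^'n)" by (rule AE_lborel_singleton)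
    ultimately show ?thesis
    proof eventually_elim
      case (elim \<eta>)
      have "norm \<eta> powr (2 * (\<Sum>i\<in>?I. s i)) = (\<Prod>i\<in>?I. norm \<eta> powr (2 * s i))"
        using elim(2) by (simp add: powr_sum sum_distrib_left)
      then have "c * norm \<eta> powr (2 * (\<Sum>i\<in>?I. s i)) = (\<Prod>i\<in>?I. K i powr (2 * s i) * norm \<eta> powr (2 * s i))"
        by (simp add: c_def prod.distrib)
      also have "\<dots> \<le> (\<Prod>i\<in>?I. norm (spectral_proj A i \<eta>) powr (2 * s i))"
      proof (rule prod_mono)
        fix i assume i: "i \<in> ?I"
        have "(norm \<eta> * K i) powr (2 * s i) \<le> norm (spectral_proj A i \<eta>) powr (2 * s i)"
          using elim(1) i K(2)[OF i] s[OF i] by (intro powr_mono2') auto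
        then show "0 \<le> K i powr (2 * s i) * norm \<eta> powr (2 * s i) \<and>
            K i powr (2 * s i) * norm \<eta> powr (2 * s i) \<le> norm (spectral_proj A i \<eta>) powr (2 * s i)"
          using K(1)[OF i] by (simp add: powr_mult mult.commute)
      qed
      finally show ?case .
    qed
  qed
  ultimately show ?thesis by blast
qed

text \<open>Finiteness of the integral over the base gives finiteness at almost every base point only if
  the inner integral is measurable in that point.\<close>

lemma measurable_fibre_energy:
  fixes A :: "real^'n^'n"
  assumes l: "0 < l" and \<phi>: "C_circle r \<phi>" and w [measurable]: "w \<in> borel_measurable borel"
  shows "(\<lambda>x. \<integral>\<^sup>+\<eta>. ennreal ((cmod (fourier_measure (srb_fibre l A \<phi> x) \<eta>))\<^sup>2 * w \<eta>) \<partial>lborel)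
    \<in> borel_measurable circle_measure"
proof -
  let ?\<nu> = "bernoulli_measure l"
  interpret \<nu>: prob_space ?\<nu> by (rule prob_space_bernoulli_measure[OF l])
  have "(\<lambda>q. (fst (fst q), snd q)) \<in> measurable ((circle_measure \<Otimes>\<^sub>M (lborel :: (real^'n) measure)) \<Otimes>\<^sub>M ?\<nu>) (circle_measure \<Otimes>\<^sub>M ?\<nu>)"
    by measurable
  from measurable_compose[OF this measurable_S_sum[OF l \<phi>, of A]]
  have [measurable]: "(\<lambda>q. S_sum l A \<phi> (fst (fst q)) (snd q))
      \<in> borel_measurable ((circle_measure \<Otimes>\<^sub>M (lborel :: (real^'n) measure)) \<Otimes>\<^sub>M ?\<nu>)"
    by simp
  have "(\<lambda>p. LINT a|?\<nu>. cis (- (2 * pi * (snd p \<bullet> S_sum l A \<phi> (fst p) a))))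
      \<in> borel_measurable (circle_measure \<Otimes>\<^sub>M (lborel :: (real^'n) measure))"
    by (rule \<nu>.borel_measurable_lebesgue_integral) (simp add: case_prod_beta', measurable)
  then have [measurable]: "(\<lambda>(x, \<eta>). LINT a|?\<nu>. cis (- (2 * pi * (\<eta> \<bullet> S_sum l A \<phi> x a))))
      \<in> borel_measurable (circle_measure \<Otimes>\<^sub>M (lborel :: (real^'n) measure))"
    by (simp add: case_prod_beta')
  have "(\<lambda>x. \<integral>\<^sup>+\<eta>. ennreal ((cmod (LINT a|?\<nu>. cis (- (2 * pi * (\<eta> \<bullet> S_sum l A \<phi> x a)))))\<^sup>2 * w \<eta>) \<partial>lborel)
      \<in> borel_measurable circle_measure"
    by measurable
  then show ?thesis
  proof (rule measurable_cong[THEN iffD1, rotated])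
    fix x assume "x \<in> space circle_measure"
    then have x: "x \<in> {0..<1}" by simp
    have "fourier_measure (srb_fibre l A \<phi> x) \<eta> = (LINT a|?\<nu>. cis (- (2 * pi * (\<eta> \<bullet> S_sum l A \<phi> x a))))" for \<eta>
      unfolding fourier_measure_def srb_fibre_def
      by (rule integral_distr[OF measurable_S_sum_fibre[OF l \<phi> x]]) measurable
    then show "(\<integral>\<^sup>+\<eta>. ennreal ((cmod (LINT a|?\<nu>. cis (- (2 * pi * (\<eta> \<bullet> S_sum l A \<phi> x a)))))\<^sup>2 * w \<eta>) \<partial>lborel)
        = (\<integral>\<^sup>+\<eta>. ennreal ((cmod (fourier_measure (srb_fibre l A \<phi> x) \<eta>))\<^sup>2 * w \<eta>) \<partial>lborel)"
      by simp
  qed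
qed

text \<open>The common source of both conclusions.\<close>

lemma fibre_correlation_bound:
  fixes A :: "real^'n^'n" and s :: "nat \<Rightarrow> real"
  assumes l: "0 < l" and \<phi>: "C_circle r \<phi>"
    and s: "\<And>i. i \<in> {1..num_moduli A} \<Longrightarrow> s i \<le> 0"
    and d: "\<And>i. i \<in> {1..num_moduli A} \<Longrightarrow> 0 < dim (spectral_space A i)"
    and H: "in_L2_H A s (srb_measure l A \<phi>)"
  shows "AE x in circle_measure. \<exists>C\<ge>0. \<forall>\<epsilon>>0.
      (\<integral>\<^sup>+y. emeasure (srb_fibre l A \<phi> x) (cball y \<epsilon>) \<partial>srb_fibre l A \<phi> x)
        \<le> ennreal (C * \<epsilon> powr (CARD('n) + 2 * (\<Sum>i\<in>{1..num_moduli A}. s i)))"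
proof -
  let ?S = "\<Sum>i\<in>{1..num_moduli A}. s i"
  define w where "w \<eta> = (\<Prod>i\<in>{1..num_moduli A}. norm (spectral_proj A i \<eta>) powr (2 * s i))" for \<eta>
  have [measurable]: "spectral_proj A i \<in> borel_measurable borel" if "i \<in> {1..num_moduli A}" for i
    using linear_spectral_proj[OF that] linear_conv_bounded_linear
    by (intro borel_measurable_continuous_onI linear_continuous_on) blast
  have w_meas [measurable]: "w \<in> borel_measurable borel"
    unfolding w_def by measurable
  obtain c where c: "0 < c" "AE \<eta> in lborel. c * norm \<eta> powr (2 * ?S) \<le> w \<eta>"
    using spectral_weight_ge[of A s, OF s d] unfolding w_def by blast
  obtain \<kappa> where \<kappa>: "disintegration (srb_measure l A \<phi>) \<kappa>"
    and fin: "(\<integral>\<^sup>+x. (\<integral>\<^sup>+\<eta>. ennreal ((cmod (fourier_measure (\<kappa> x) \<eta>))\<^sup>2 * w \<eta>) \<partial>lborel) \<partial>circle_measure) < \<infinity>"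
    using H unfolding in_L2_H_def w_def by blast
  let ?E = "\<lambda>x. \<integral>\<^sup>+\<eta>. ennreal ((cmod (fourier_measure (srb_fibre l A \<phi> x) \<eta>))\<^sup>2 * w \<eta>) \<partial>lborel"
  have "AE x in circle_measure. \<kappa> x = srb_fibre l A \<phi> x"
    by (rule disintegration_unique[OF \<kappa> disintegration_srb_fibre[OF l \<phi>]])
  then have "(\<integral>\<^sup>+x. ?E x \<partial>circle_measure)
      = (\<integral>\<^sup>+x. (\<integral>\<^sup>+\<eta>. ennreal ((cmod (fourier_measure (\<kappa> x) \<eta>))\<^sup>2 * w \<eta>) \<partial>lborel) \<partial>circle_measure)"
    by (intro nn_integral_cong_AE) (auto elim: eventually_mono)
  with fin have "AE x in circle_measure. ?E x \<noteq> \<infinity>"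
    using measurable_fibre_energy[OF l \<phi> w_meas, of A] by (intro nn_integral_PInf_AE) auto
  then show ?thesis
  proof (rule AE_mp, intro AE_I2 impI)
    fix x assume "x \<in> space circle_measure" and E: "?E x \<noteq> \<infinity>"
    then have prob: "prob_space (srb_fibre l A \<phi> x)"
      using prob_space_srb_fibre[OF l \<phi>] by simp
    have "sets (srb_fibre l A \<phi> x) = sets borel" by (simp add: srb_fibre_def)
    moreover have "?S \<le> 0" using s by (intro sum_nonpos)
    moreover have "?E x < \<infinity>" using E by (simp add: less_top)
    ultimately obtain C where "0 \<le> C" "\<And>\<epsilon>. 0 < \<epsilon> \<Longrightarrow>
        (\<integral>\<^sup>+y. emeasure (srb_fibre l A \<phi> x) (cball y \<epsilon>) \<partial>srb_fibre l A \<phi> x)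
          \<le> ennreal (C * \<epsilon> powr (CARD('n) + 2 * ?S))"
      using correlation_bound[OF prob _ _ c w_meas] by blast
    then show "\<exists>C\<ge>0. \<forall>\<epsilon>>0. (\<integral>\<^sup>+y. emeasure (srb_fibre l A \<phi> x) (cball y \<epsilon>) \<partial>srb_fibre l A \<phi> x)
        \<le> ennreal (C * \<epsilon> powr (CARD('n) + 2 * ?S))" by blast
  qed
qed

lemma srb_measure_absolutely_continuous:
  fixes A :: "real^'n^'n"
  assumes l: "0 < l" and \<phi>: "C_circle r \<phi>"
    and fib: "AE x in circle_measure. absolutely_continuous lborel (srb_fibre l A \<phi> x)"
  shows "absolutely_continuous (circle_measure \<Otimes>\<^sub>M lborel) (srb_measure l A \<phi>)"
  unfolding absolutely_continuous_def
proof
  fix N :: "(real \<times> (real^'n)) set"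
  assume N: "N \<in> null_sets (circle_measure \<Otimes>\<^sub>M lborel)"
  have dis: "disintegration (srb_measure l A \<phi>) (srb_fibre l A \<phi>)"
    by (rule disintegration_srb_fibre[OF l \<phi>])
  have "sets (circle_measure \<Otimes>\<^sub>M (lborel :: (real^'n) measure)) = sets (circle_measure \<Otimes>\<^sub>M borel)"
    by (rule sets_pair_measure_cong) simp_all
  then have N_sets: "N \<in> sets (srb_measure l A \<phi>)"
    using N dis by (auto simp: disintegration_def null_sets_def)
  have "(\<integral>\<^sup>+x. emeasure lborel (Pair x -` N) \<partial>circle_measure) = 0"
    using N by (subst lborel.emeasure_pair_measure_alt[symmetric]) (auto simp: null_sets_def)
  then have "AE x in circle_measure. emeasure lborel (Pair x -` N) = 0"
    using N by (subst (asm) nn_integral_0_iff_AE) (auto intro!: lborel.measurable_emeasure_Pair)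
  with fib have "AE x in circle_measure. emeasure (srb_fibre l A \<phi> x) (Pair x -` N) = 0"
  proof eventually_elim
    case (elim x)
    have "Pair x -` N \<in> sets lborel" using N by (intro sets_Pair1) (auto simp: null_sets_def)
    then have "Pair x -` N \<in> null_sets lborel" using elim(2) by (simp add: null_sets_def)
    then show ?case using elim(1) by (auto simp: absolutely_continuous_def null_sets_def)
  qed
  then have "(\<integral>\<^sup>+x. emeasure (srb_fibre l A \<phi> x) (Pair x -` N) \<partial>circle_measure) = (\<integral>\<^sup>+x. 0 \<partial>circle_measure)"
    by (rule nn_integral_cong_AE)
  then have "emeasure (srb_measure l A \<phi>) N = 0"
    using dis N_sets by (simp add: disintegration_def)
  then show "N \<in> null_sets (srb_measure l A \<phi>)" using N_sets by (simp add: null_sets_def)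
qed

theorem theorem3:
  fixes A :: "real^'n^'n" and \<phi> :: "real \<Rightarrow> real^'n" and l r :: nat and s :: "nat \<Rightarrow> real"
  assumes "l \<ge> 2" and "r \<ge> 2"
    and "invertible A" and "spectral_radius A < 1"
    and "C_circle r \<phi>"
    and "\<And>i. i \<in> {1..num_moduli A} \<Longrightarrow> s i > - real (dim (spectral_space A i)) / 2"
    and "in_L2_H A s (srb_measure l A \<phi>)"
  shows "((\<forall>i\<in>{1..num_moduli A}. - real (dim (spectral_space A i)) / 2 < s i \<and> s i < 0) \<longrightarrow>
           (AE x in circle_measure.
              hausdorff_dim_measure (srb_fibre l A \<phi> x)
                \<ge> ereal (real CARD('n) + 2 * (\<Sum>i\<in>{1..num_moduli A}. s i)))) \<and>
         ((\<forall>i\<in>{1..num_moduli A}. s i = 0) \<longrightarrow>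
           absolutely_continuous (circle_measure \<Otimes>\<^sub>M lborel) (srb_measure l A \<phi>))"
proof -
  have l: "0 < l" using assms(1) by simp
  note \<phi> = assms(5)
  have sets: "sets (srb_fibre l A \<phi> x) = sets borel" for x by (simp add: srb_fibre_def)
  have corr: "AE x in circle_measure. \<exists>C\<ge>0. \<forall>\<epsilon>>0.
      (\<integral>\<^sup>+y. emeasure (srb_fibre l A \<phi> x) (cball y \<epsilon>) \<partial>srb_fibre l A \<phi> x)
        \<le> ennreal (C * \<epsilon> powr (CARD('n) + 2 * (\<Sum>i\<in>{1..num_moduli A}. s i)))"
    if s: "\<forall>i\<in>{1..num_moduli A}. s i \<le> 0"
  proof (rule fibre_correlation_bound[OF l \<phi> _ _ assms(7)])
    fix i assume i: "i \<in> {1..num_moduli A}"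
    show "s i \<le> 0" using s i by blast
    \<comment> \<open>The strict lower bound on the nonpositive \<open>s i\<close> forces the spectral space to be nonzero.\<close>
    have "- real (dim (spectral_space A i)) / 2 < 0" using assms(6)[OF i] s i by force
    then show "0 < dim (spectral_space A i)" by simp
  qed
  show ?thesis
  proof (intro conjI impI)
    assume "\<forall>i\<in>{1..num_moduli A}. - real (dim (spectral_space A i)) / 2 < s i \<and> s i < 0"
    then have "\<forall>i\<in>{1..num_moduli A}. s i \<le> 0" by force
    from corr[OF this] show "AE x in circle_measure. hausdorff_dim_measure (srb_fibre l A \<phi> x)
        \<ge> ereal (real CARD('n) + 2 * (\<Sum>i\<in>{1..num_moduli A}. s i))"
    proof (rule AE_mp, intro AE_I2 impI)
      fix x assume "x \<in> space circle_measure" and C: "\<exists>C\<ge>0. \<forall>\<epsilon>>0.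
        (\<integral>\<^sup>+y. emeasure (srb_fibre l A \<phi> x) (cball y \<epsilon>) \<partial>srb_fibre l A \<phi> x)
          \<le> ennreal (C * \<epsilon> powr (CARD('n) + 2 * (\<Sum>i\<in>{1..num_moduli A}. s i)))"
      then have prob: "prob_space (srb_fibre l A \<phi> x)"
        using prob_space_srb_fibre[OF l \<phi>] by simp
      from C show "hausdorff_dim_measure (srb_fibre l A \<phi> x)
          \<ge> ereal (real CARD('n) + 2 * (\<Sum>i\<in>{1..num_moduli A}. s i))"
        using hausdorff_dim_measure_ge[OF prob sets] by blast
    qed
  next
    assume s0: "\<forall>i\<in>{1..num_moduli A}. s i = 0"
    then have le: "\<forall>i\<in>{1..num_moduli A}. s i \<le> 0" and sum0: "(\<Sum>i\<in>{1..num_moduli A}. s i) = 0"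
      by simp_all
    show "absolutely_continuous (circle_measure \<Otimes>\<^sub>M lborel) (srb_measure l A \<phi>)"
    proof (rule srb_measure_absolutely_continuous[OF l \<phi>], rule AE_mp[OF corr[OF le]], intro AE_I2 impI)
      fix x assume x: "x \<in> space circle_measure" and "\<exists>C\<ge>0. \<forall>\<epsilon>>0.
        (\<integral>\<^sup>+y. emeasure (srb_fibre l A \<phi> x) (cball y \<epsilon>) \<partial>srb_fibre l A \<phi> x)
          \<le> ennreal (C * \<epsilon> powr (CARD('n) + 2 * (\<Sum>i\<in>{1..num_moduli A}. s i)))"
      then obtain C where C: "0 \<le> C" "\<And>\<epsilon>. 0 < \<epsilon> \<Longrightarrow>
        (\<integral>\<^sup>+y. emeasure (srb_fibre l A \<phi> x) (cball y \<epsilon>) \<partial>srb_fibre l A \<phi> x)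
          \<le> ennreal (C * \<epsilon> ^ DIM(real^'n))"
        unfolding sum0 by (auto simp: powr_realpow)
      have prob: "prob_space (srb_fibre l A \<phi> x)"
        using x prob_space_srb_fibre[OF l \<phi>] by simp
      show "absolutely_continuous lborel (srb_fibre l A \<phi> x)"
        unfolding absolutely_continuous_def
      proof
        fix N :: "(real^'n) set" assume N: "N \<in> null_sets lborel"
        have "emeasure (srb_fibre l A \<phi> x) N = 0"
          by (rule absolutely_continuous_of_correlation[OF prob sets C N])
        then show "N \<in> null_sets (srb_fibre l A \<phi> x)" using N by (simp add: null_sets_def sets)
      qed
    qed
  qed
qed

end
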